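(* Let $\Omega\subset\mathbb{C}^n$ be a bounded Reinhardt domain. If $\varphi:\Omega\to\mathbb{R}$ is uniformly continuous on $\Omega$, then the Perron–Bremermann envelope $$P(\varphi) := \sup\{u(z) : u \in \mathcal{PSH}(\Omega),\ u^* \le \varphi\}$$ belongs to $C(\Omega)$.
   Context: $\mathcal{PSH}(\Omega)$ denotes the plurisubharmonic functions on $\Omega$, and $u^*$ is the upper semicontinuous regularization of $u$ (equal to $u$ on $\Omega$ for plurisubharmonic $u$). A Reinhardt domain is a domain invariant under the toric action $(z_1,\dots,z_n)\mapsto(e^{i\theta_1}z_1,\dots,e^{i\theta_n}z_n)$, $\theta_j\in\mathbb{R}$. *)

theory Defs
  imports "HOL-Analysis.Analysis"
begin

definition domain_in :: "'a::topological_space set \<Rightarrow> bool" where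
  "domain_in S \<longleftrightarrow> open S \<and> connected S \<and> S \<noteq> {}"

definition Reinhardt :: "(complex ^ 'n) set \<Rightarrow> bool" where
  "Reinhardt S \<longleftrightarrow> (\<forall>\<theta> :: real ^ 'n. \<forall>z\<in>S. (\<chi> j. exp (\<i> * of_real (\<theta> $ j)) * z $ j) \<in> S)"

definition usc_on :: "'a::topological_space set \<Rightarrow> ('a \<Rightarrow> ereal) \<Rightarrow> bool" where
  "usc_on S f \<longleftrightarrow> (\<forall>c. openin (top_of_set S) {x \<in> S. f x < c})"

(* The upper limit is over all y in S tending to x, and y = x is admitted when x lies in S. *)
definition usc_regularization :: "'a::topological_space set \<Rightarrow> ('a \<Rightarrow> ereal) \<Rightarrow> 'a \<Rightarrow> ereal" where
  "usc_regularization S f x = Limsup (inf (nhds x) (principal S)) f"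

lemma usc_regularization_eq:
  assumes u: "usc_on S f" and x: "x \<in> S"
  shows "usc_regularization S f x = f x"
proof (rule antisym)
  show "usc_regularization S f x \<le> f x"
  proof (rule dense_ge)
    fix c assume "f x < c"
    obtain T where T: "open T" "{y \<in> S. f y < c} = S \<inter> T"
      using u unfolding usc_on_def openin_open by blast
    have "x \<in> T" using T x \<open>f x < c\<close> by blast
    have "eventually (\<lambda>y. f y \<le> c) (inf (nhds x) (principal S))"
      unfolding eventually_inf_principal eventually_nhds
      using T \<open>x \<in> T\<close> by (intro exI[of _ T]) (auto intro: less_imp_le)
    then show "usc_regularization S f x \<le> c" unfolding usc_regularization_def by (rule Limsup_bounded)
  qed
  show "f x \<le> usc_regularization S f x"
    unfolding usc_regularization_def Limsup_def le_INF_iff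
  proof clarsimp
    fix P assume "eventually P (inf (nhds x) (principal S))"
    then have "P x" using x by (auto simp: eventually_inf_principal eventually_nhds)
    then show "f x \<le> Sup (f ` Collect P)" by (auto intro: SUP_upper)
  qed
qed

(* Extended-valued Lebesgue integral, positive part minus negative part; e2ennreal truncates
   negative values to 0.  It is meaningful when one of the two parts is finite, as is the case
   for the positive part of an upper semicontinuous function without the value \<infinity> on a compact
   set. *)
definition extended_integral :: "'a measure \<Rightarrow> ('a \<Rightarrow> ereal) \<Rightarrow> ereal" where
  "extended_integral M f =
     enn2ereal (\<integral>\<^sup>+ x. e2ennreal (f x) \<partial>M) - enn2ereal (\<integral>\<^sup>+ x. e2ennreal (- f x) \<partial>M)"

definition circle_mean :: "(complex \<Rightarrow> ereal) \<Rightarrow> complex \<Rightarrow> real \<Rightarrow> ereal" where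
  "circle_mean u a r =
     extended_integral (restrict_space lborel {0..2 * pi})
       (\<lambda>t. u (a + of_real r * exp (\<i> * of_real t))) / ereal (2 * pi)"

(* The function identically -\<infinity> is allowed here and in the next definition. *)
definition subharmonic_on :: "complex set \<Rightarrow> (complex \<Rightarrow> ereal) \<Rightarrow> bool" where
  "subharmonic_on D u \<longleftrightarrow>
     usc_on D u \<and> (\<forall>z\<in>D. u z < \<infinity>) \<and>
     (\<forall>a r. r > 0 \<and> cball a r \<subseteq> D \<longrightarrow> u a \<le> circle_mean u a r)"

definition psh_on :: "(complex ^ 'n) set \<Rightarrow> (complex ^ 'n \<Rightarrow> ereal) \<Rightarrow> bool" where
  "psh_on \<Omega> u \<longleftrightarrow>
     usc_on \<Omega> u \<and> (\<forall>z\<in>\<Omega>. u z < \<infinity>) \<and>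
     (\<forall>a b. subharmonic_on {\<zeta>. a + \<zeta> *s b \<in> \<Omega>} (\<lambda>\<zeta>. u (a + \<zeta> *s b)))"

definition Perron_Bremermann ::
  "(complex ^ 'n) set \<Rightarrow> (complex ^ 'n \<Rightarrow> real) \<Rightarrow> complex ^ 'n \<Rightarrow> ereal" where
  "Perron_Bremermann \<Omega> \<phi> z =
     (SUP u \<in> {u. psh_on \<Omega> u \<and> (\<forall>w\<in>\<Omega>. usc_regularization \<Omega> u w \<le> ereal (\<phi> w))}. u z)"

end

theory Submission
  imports Defs
begin

text \<open>
  The upper semicontinuous regularization of the envelope is plurisubharmonic and still at most \<open>\<phi>\<close>, so it is a
  competitor and the envelope is upper semicontinuous and plurisubharmonic itself. If a rotation of the coordinates
  changes \<open>\<phi>\<close> by at most \<open>e\<close>, then the rotated envelope minus \<open>e\<close> is a competitor as well; hence the envelope is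
  uniformly continuous along the tori. For lower semicontinuity at \<open>z\<close> the coordinates are changed one at a time.
  In one variable, a low value at a point \<open>b\<close> close to \<open>a\<close> spreads by rotation over an arc of the circle
  \<open>\<bar>\<zeta>\<bar> = \<bar>b\<bar>\<close>, while upper semicontinuity bounds the function near \<open>a\<close> by little more than its value at
  \<open>a\<close>. This contradicts the submean inequality over that circle if \<open>a = 0\<close>, and otherwise the maximum principle
  with a quadratic barrier on one side of the arc.
\<close>

subsection \<open>Upper semicontinuity and circle averages\<close>

lemma usc_on_eventually:
  fixes f :: "'a::topological_space \<Rightarrow> ereal"
  shows "usc_on S f \<longleftrightarrow> (\<forall>x\<in>S. \<forall>c. f x < c \<longrightarrow> (\<forall>\<^sub>F y in at x within S. f y < c))"
proof
  assume u: "usc_on S f"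
  show "\<forall>x\<in>S. \<forall>c. f x < c \<longrightarrow> (\<forall>\<^sub>F y in at x within S. f y < c)"
  proof (intro ballI allI impI)
    fix x c assume "x \<in> S" "f x < c"
    obtain T where "open T" "{y \<in> S. f y < c} = S \<inter> T"
      using u unfolding usc_on_def openin_open by blast
    with \<open>x \<in> S\<close> \<open>f x < c\<close> show "\<forall>\<^sub>F y in at x within S. f y < c"
      unfolding eventually_at_topological by blast
  qed
next
  assume l: "\<forall>x\<in>S. \<forall>c. f x < c \<longrightarrow> (\<forall>\<^sub>F y in at x within S. f y < c)"
  show "usc_on S f" unfolding usc_on_def
  proof (intro allI)
    fix c
    show "openin (top_of_set S) {x \<in> S. f x < c}"
    proof (subst openin_subopen, intro ballI)
      fix x assume x: "x \<in> {x \<in> S. f x < c}"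
      then obtain T where "open T" "x \<in> T" "\<forall>y\<in>T. y \<noteq> x \<longrightarrow> y \<in> S \<longrightarrow> f y < c"
        using l unfolding eventually_at_topological by blast
      with x show "\<exists>T. openin (top_of_set S) T \<and> x \<in> T \<and> T \<subseteq> {x \<in> S. f x < c}"
        by (intro exI[of _ "S \<inter> T"]) (auto simp: openin_open)
    qed
  qed
qed

lemma usc_on_compose:
  assumes "usc_on S f" "continuous_on T g" "g ` T \<subseteq> S"
  shows "usc_on T (\<lambda>x. f (g x))"
  unfolding usc_on_def
proof
  fix c
  have "openin (top_of_set T) (T \<inter> g -` {x \<in> S. f x < c})"
    using assms unfolding usc_on_def
    by (intro continuous_openin_preimage[where T = S]) auto
  moreover have "T \<inter> g -` {x \<in> S. f x < c} = {x \<in> T. f (g x) < c}" using assms(3) by auto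
  ultimately show "openin (top_of_set T) {x \<in> T. f (g x) < c}" by simp
qed

lemma usc_on_subset: "usc_on S f \<Longrightarrow> T \<subseteq> S \<Longrightarrow> usc_on T f"
  using usc_on_compose[of S f T "\<lambda>x. x"] by auto

lemma usc_on_cong: "(\<And>x. x \<in> S \<Longrightarrow> f x = g x) \<Longrightarrow> usc_on S f \<longleftrightarrow> usc_on S g"
  unfolding usc_on_def by (metis (mono_tags, lifting) Collect_cong)

lemma usc_on_diff_continuous:
  assumes f: "usc_on S (\<lambda>x. ereal (f x))" and q: "continuous_on S q"
  shows "usc_on S (\<lambda>x. ereal (f x - q x))"
  unfolding usc_on_eventually
proof (intro ballI allI impI)
  fix x c assume x: "x \<in> S" and c: "ereal (f x - q x) < c"
  obtain d where d: "f x - q x < d" "ereal d < c"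
    using c by (metis ereal_dense2 ereal_less(2) less_ereal.simps(1))
  define e where "e = (d - (f x - q x)) / 2"
  have e: "e > 0" using d by (simp add: e_def)
  have "\<forall>\<^sub>F y in at x within S. ereal (f y) < ereal (f x + e)"
    using f x e unfolding usc_on_eventually by (metis less_add_same_cancel1 less_ereal.simps(1))
  moreover have "\<forall>\<^sub>F y in at x within S. q x - e < q y"
    using q x e by (intro order_tendstoD(1)[of q "q x"]) (auto simp: continuous_on_def)
  ultimately show "\<forall>\<^sub>F y in at x within S. ereal (f y - q y) < c"
  proof eventually_elim
    case (elim y)
    then have "f y - q y < d" by (simp add: e_def field_simps)
    then show ?case using d(2) by (metis less_ereal.simps(1) order_less_trans)
  qed
qed

text \<open>If no maximum is attained, every point has a neighbourhood on which \<open>f\<close>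
  stays below some value taken on \<open>K\<close>. Finitely many such neighbourhoods suffice, and
  the largest of their values is itself taken at a point of \<open>K\<close>, where it would have to
  lie below one of them.\<close>

lemma usc_on_attains_max:
  fixes f :: "'a::topological_space \<Rightarrow> ereal"
  assumes "usc_on K f" "compact K" "K \<noteq> {}"
  shows "\<exists>p\<in>K. \<forall>x\<in>K. f x \<le> f p"
proof (rule ccontr)
  assume "\<not> ?thesis"
  then have "\<forall>x\<in>K. \<exists>y\<in>K. f x < f y" by (auto simp: not_le)
  then obtain y where y: "\<And>x. x \<in> K \<Longrightarrow> y x \<in> K \<and> f x < f (y x)" by metis
  have "\<exists>c T. c \<in> f ` K \<and> open T \<and> x \<in> T \<and> (\<forall>y\<in>K \<inter> T. f y < c)" if x: "x \<in> K" for x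
  proof -
    obtain T where "open T" "{z \<in> K. f z < f (y x)} = K \<inter> T"
      using assms(1) unfolding usc_on_def openin_open by blast
    with y[OF x] x show ?thesis by (intro exI[of _ "f (y x)"] exI[of _ T]) blast
  qed
  then obtain c T where cT: "\<And>x. x \<in> K \<Longrightarrow> c x \<in> f ` K \<and> open (T x) \<and> x \<in> T x \<and> (\<forall>y\<in>K \<inter> T x. f y < c x)"
    by metis
  obtain D where D: "D \<subseteq> K" "finite D" "K \<subseteq> (\<Union>x\<in>D. T x)"
    using compactE_image[OF assms(2), of K T] cT by blast
  have "D \<noteq> {}" using D assms(3) by auto
  then have "Max (c ` D) \<in> c ` D" using D by (intro Max_in) auto
  then obtain y where y: "y \<in> K" "f y = Max (c ` D)" using cT D by (metis (no_types, lifting) imageE subsetD)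
  obtain x where "x \<in> D" "y \<in> T x" using y D by blast
  then have "f y < c x" using cT D y by blast
  also have "c x \<le> Max (c ` D)" using D \<open>x \<in> D\<close> by auto
  finally show False using y by simp
qed

section \<open>Averages of real functions over a circle\<close>

text \<open>Real counterpart of \<open>circle_mean\<close>. The Bochner integral is 0 for a
  non-integrable function, so comparisons of averages carry \<open>circle_integrable\<close> as an
  assumption.\<close>

definition circle_avg :: "(real \<Rightarrow> real) \<Rightarrow> real" where
  "circle_avg g = (LINT t|restrict_space lborel {0..2 * pi}. g t) / (2 * pi)"

abbreviation circle_integrable :: "(real \<Rightarrow> real) \<Rightarrow> bool" where
  "circle_integrable g \<equiv> integrable (restrict_space lborel {0..2 * pi}) g"

lemma space_arc [simp]: "space (restrict_space lborel {0..2 * pi}) = {0..2 * pi}"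
  by (simp add: space_restrict_space)

lemma finite_measure_arc: "finite_measure (restrict_space lborel {0..2 * pi})"
  by (intro finite_measureI) (simp add: emeasure_restrict_space)

lemma circle_integrable_borel_bounded:
  assumes "g \<in> borel_measurable (restrict_space lborel {0..2 * pi})" "\<And>t. t \<in> {0..2 * pi} \<Longrightarrow> \<bar>g t\<bar> \<le> B"
  shows "circle_integrable g"
  using assms by (intro finite_measure.integrable_const_bound[OF finite_measure_arc, of _ B])
    (auto intro!: AE_I2)

lemma usc_on_borel_measurable:
  assumes "usc_on {0..2 * pi} (\<lambda>t. ereal (g t))"
  shows "g \<in> borel_measurable (restrict_space lborel {0..2 * pi})"
  unfolding borel_measurable_iff_less
proof
  fix c
  obtain T where T: "open T" "{t \<in> {0..2 * pi}. ereal (g t) < ereal c} = {0..2 * pi} \<inter> T"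
    using assms unfolding usc_on_def openin_open by blast
  have "{t \<in> {0..2 * pi}. g t < c} = {0..2 * pi} \<inter> T" using T(2) by simp
  then show "{w \<in> space (restrict_space lborel {0..2 * pi}). g w < c} \<in> sets (restrict_space lborel {0..2 * pi})"
    using T(1) by (auto simp: sets_restrict_space)
qed

lemma circle_avg_const [simp]: "circle_avg (\<lambda>_. c) = c"
  unfolding circle_avg_def
  by (simp add: measure_restrict_space integral_restrict_space)

lemma circle_avg_mono:
  assumes "circle_integrable f" "circle_integrable g" "\<And>t. t \<in> {0..2 * pi} \<Longrightarrow> f t \<le> g t"
  shows "circle_avg f \<le> circle_avg g"
  unfolding circle_avg_def using assms
  by (intro divide_right_mono integral_mono) auto

lemma circle_avg_add_const:
  assumes "circle_integrable f"
  shows "circle_avg (\<lambda>t. f t + c) = circle_avg f + c"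
proof -
  interpret finite_measure "restrict_space lborel {0..2 * pi}" by (rule finite_measure_arc)
  have "circle_avg (\<lambda>t. f t + c) = circle_avg f + circle_avg (\<lambda>_. c)"
    unfolding circle_avg_def using assms by (simp add: add_divide_distrib)
  then show ?thesis by simp
qed

text \<open>Positive and negative parts are compared by monotonicity of \<open>nn_integral\<close>.
  A competitor that may take the value \<open>-\<infinity>\<close> can thus be compared with a
  real-valued majorant.\<close>

lemma circle_mean_mono:
  assumes "\<And>t. t \<in> {0..2 * pi} \<Longrightarrow>
    u (a + of_real r * exp (\<i> * of_real t)) \<le> v (b + of_real s * exp (\<i> * of_real t))"
  shows "circle_mean u a r \<le> circle_mean v b s"
  unfolding circle_mean_def extended_integral_def
  by (intro ereal_divide_right_mono ereal_minus_mono)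
    (auto intro!: nn_integral_mono e2ennreal_mono assms simp: less_eq_ennreal.rep_eq[symmetric])

text \<open>Integrability makes both parts finite, so their extended difference is the Bochner
  integral and real arithmetic is available.\<close>

lemma circle_mean_ereal:
  assumes "circle_integrable (\<lambda>t. f (a + of_real r * exp (\<i> * of_real t)))"
  shows "circle_mean (\<lambda>z. ereal (f z)) a r =
    ereal (circle_avg (\<lambda>t. f (a + of_real r * exp (\<i> * of_real t))))"
proof -
  define g where "g t = f (a + of_real r * exp (\<i> * of_real t))" for t :: real
  define S where "S = restrict_space lborel {0..2 * pi}"
  have i: "integrable S g" using assms unfolding S_def g_def[abs_def] .
  have 1: "(\<integral>\<^sup>+t. ennreal (g t) \<partial>S) < top" "(\<integral>\<^sup>+t. ennreal (- g t) \<partial>S) < top"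
    using i by (auto simp: real_integrable_def top.not_eq_extremum)
  have e: "enn2ereal x = ereal (enn2real x)" if "x < top" for x
    using that by (metis enn2ereal_ennreal enn2real_nonneg ennreal_enn2real)
  have "extended_integral S (\<lambda>t. ereal (g t)) = ereal (integral\<^sup>L S g)"
    unfolding extended_integral_def real_lebesgue_integral_def[OF i]
    using e[OF 1(1)] e[OF 1(2)] by simp
  then show ?thesis
    unfolding circle_mean_def circle_avg_def S_def[symmetric] g_def[symmetric] by simp
qed

text \<open>The oscillating terms have a periodic antiderivative. A real quadratic polynomial
  restricted to a circle has this form, with its mean as constant term.\<close>

lemma circle_avg_trig:
  "circle_avg (\<lambda>t. c + Re (A * exp (\<i> * of_real t)) + Re (B * exp (\<i> * of_real t) ^ 2)) = c"
  "circle_integrable (\<lambda>t. c + Re (A * exp (\<i> * of_real t)) + Re (B * exp (\<i> * of_real t) ^ 2))"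
proof -
  define g where "g t = c + Re (A * exp (\<i> * of_real t)) + Re (B * exp (\<i> * of_real t) ^ 2)" for t
  define F where "F t = c * t + Re A * sin t + Im A * cos t + Re B * sin (2 * t) / 2 + Im B * cos (2 * t) / 2" for t
  have g: "g t = c + (Re A * cos t - Im A * sin t) + (Re B * cos (2 * t) - Im B * sin (2 * t))" for t
  proof -
    have "exp (\<i> * of_real t) ^ 2 = exp (\<i> * of_real (2 * t))"
      by (simp add: exp_double[symmetric] mult_ac)
    then show ?thesis
      unfolding g_def by (simp add: exp_Euler cos_of_real sin_of_real del: of_real_mult)
  qed
  have "(F has_vector_derivative g t) (at t within {0..2*pi})" for t
    unfolding has_real_derivative_iff_has_vector_derivative[symmetric] F_def g
    by (auto intro!: derivative_eq_intros)
  moreover have c: "continuous_on UNIV g" unfolding g_def by (intro continuous_intros)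
  ultimately have "(LINT t|lborel. indicator {0..2 * pi} t *\<^sub>R g t) = F (2*pi) - F 0"
    by (intro integral_FTC_Icc) (auto intro: continuous_on_subset)
  also have "\<dots> = c * (2 * pi)" using sin_npi[of 4] cos_npi[of 4] by (simp add: F_def)
  finally have "circle_avg g = c" unfolding circle_avg_def by (simp add: integral_restrict_space)
  then show "circle_avg (\<lambda>t. c + Re (A * exp (\<i> * of_real t)) + Re (B * exp (\<i> * of_real t) ^ 2)) = c"
    unfolding g_def[abs_def] .
  have "integrable lborel (\<lambda>t. indicator {0..2 * pi} t *\<^sub>R g t)"
    using c by (intro borel_integrable_compact) (auto intro: continuous_on_subset)
  then show "circle_integrable (\<lambda>t. c + Re (A * exp (\<i> * of_real t)) + Re (B * exp (\<i> * of_real t) ^ 2))"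
    unfolding g_def[abs_def] by (simp add: integrable_restrict_space)
qed

subsection \<open>Functions of one variable almost invariant under rotation\<close>

definition subavg_on :: "complex set \<Rightarrow> (complex \<Rightarrow> real) \<Rightarrow> bool" where
  "subavg_on D f \<longleftrightarrow>
     (\<forall>p r. r > 0 \<and> cball p r \<subseteq> D \<longrightarrow> f p \<le> circle_avg (\<lambda>t. f (p + of_real r * exp (\<i> * of_real t))))"

lemma circle_in_cball: "r \<ge> 0 \<Longrightarrow> p + of_real r * exp (\<i> * of_real t) \<in> cball p r"
  by (simp add: dist_norm norm_mult)

lemma circle_integrable_usc:
  assumes u: "usc_on D (\<lambda>z. ereal (f z))" and B: "\<And>z. z \<in> D \<Longrightarrow> \<bar>f z\<bar> \<le> B"
    and c: "continuous_on {0..2 * pi} c" "c ` {0..2 * pi} \<subseteq> D"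
  shows "circle_integrable (\<lambda>t. f (c t))"
proof (rule circle_integrable_borel_bounded)
  show "(\<lambda>t. f (c t)) \<in> borel_measurable (restrict_space lborel {0..2 * pi})"
    using usc_on_compose[OF u c] by (intro usc_on_borel_measurable)
  show "\<bar>f (c t)\<bar> \<le> B" if "t \<in> {0..2 * pi}" for t using B c that by blast
qed

lemma circle_integrable_usc_cball:
  assumes "usc_on D (\<lambda>z. ereal (f z))" "\<And>z. z \<in> D \<Longrightarrow> \<bar>f z\<bar> \<le> B" "cball p r \<subseteq> D" "r \<ge> 0"
  shows "circle_integrable (\<lambda>t. f (p + of_real r * exp (\<i> * of_real t)))"
proof (rule circle_integrable_usc[OF assms(1,2)])
  show "(\<lambda>t. p + of_real r * exp (\<i> * of_real t)) ` {0..2 * pi} \<subseteq> D"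
    using circle_in_cball[OF assms(4)] assms(3) by blast
qed (auto intro!: continuous_intros)

text \<open>Maximum principle: \<open>f - q\<close> attains its maximum over \<open>R\<close>, and
  by \<open>bd\<close> a positive maximum sits at an interior point. There the submean inequality
  for \<open>f\<close> contradicts the strict supermean inequality for \<open>q\<close>; strictness
  yields the contradiction at a single point, with no connectedness argument.\<close>

lemma strict_superharmonic_majorant:
  assumes u: "usc_on D (\<lambda>z. ereal (f z))" and B: "\<And>z. z \<in> D \<Longrightarrow> \<bar>f z\<bar> \<le> B"
    and f: "subavg_on D f" and R: "compact R" "R \<subseteq> D" and q: "continuous_on R q"
    and qi: "\<And>p r. r > 0 \<Longrightarrow> circle_integrable (\<lambda>t. q (p + of_real r * exp (\<i> * of_real t)))"
    and qa: "\<And>p r. r > 0 \<Longrightarrow> circle_avg (\<lambda>t. q (p + of_real r * exp (\<i> * of_real t))) < q p"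
    and bd: "\<And>z. z \<in> R - interior R \<Longrightarrow> f z \<le> q z"
    and z: "z \<in> R"
  shows "f z \<le> q z"
proof (rule ccontr)
  assume "\<not> f z \<le> q z"
  have "usc_on R (\<lambda>x. ereal (f x - q x))"
    using usc_on_subset[OF u R(2)] q by (rule usc_on_diff_continuous)
  from usc_on_attains_max[OF this R(1)] z obtain p where
    p: "p \<in> R" "\<And>x. x \<in> R \<Longrightarrow> f x - q x \<le> f p - q p" by auto
  then have "f p > q p" using z \<open>\<not> f z \<le> q z\<close> by fastforce
  then have "p \<in> interior R" using bd[of p] p by fastforce
  then obtain r where r: "r > 0" "cball p r \<subseteq> R" unfolding mem_interior_cball by blast
  let ?c = "\<lambda>t. p + of_real r * exp (\<i> * of_real t)"
  have "f p \<le> circle_avg (\<lambda>t. f (?c t))" using f r R unfolding subavg_on_def by blast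
  also have "\<dots> \<le> circle_avg (\<lambda>t. q (?c t) + (f p - q p))"
  proof (rule circle_avg_mono)
    interpret finite_measure "restrict_space lborel {0..2 * pi}" by (rule finite_measure_arc)
    show "circle_integrable (\<lambda>t. f (?c t))"
      using r R by (intro circle_integrable_usc_cball[OF u B]) auto
    show "circle_integrable (\<lambda>t. q (?c t) + (f p - q p))" using qi[OF r(1)] by simp
    show "f (?c t) \<le> q (?c t) + (f p - q p)" for t
      using p(2)[of "?c t"] r circle_in_cball[of r p t] by auto
  qed
  also have "\<dots> = circle_avg (\<lambda>t. q (?c t)) + (f p - q p)" by (rule circle_avg_add_const[OF qi[OF r(1)]])
  also have "\<dots> < f p" using qa[OF r(1), of p] by simp
  finally show False by simp
qed

text \<open>
  The Laplacian of the barrier is \<open>-2\<close>. It is small at the origin if \<open>d\<close> is small compared with \<open>t\<close>, while on the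
  region \<open>Re w \<ge> - d\<close> of the disc of radius \<open>t\<close> it is nonnegative, and bounded below by a multiple of
  \<open>t\<^sup>2\<close> on the outer circle. The constant 40 in \<open>barrier_bounds\<close> leaves room to replace the line
  \<open>Re w = - d\<close> by a circle of large radius curving away from the origin.
\<close>

definition barrier :: "real \<Rightarrow> real \<Rightarrow> complex \<Rightarrow> real" where
  "barrier t d w = (Im w)^2 - 2 * (Re w)^2 + 4 * d^2 + 3 * t * (Re w + d)"

text \<open>A quadratic polynomial averages over a circle to its central value plus
  \<open>r^2 / 4\<close> times its Laplacian, which is \<open>-2\<close> for \<open>barrier\<close>
  and is unaffected by the rotation \<open>l\<close>.\<close>

lemma barrier_circle:
  assumes l: "norm l = 1"
  shows "circle_integrable (\<lambda>s. C + N * barrier t d (l * (p + of_real r * exp (\<i> * of_real s) - a)))"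
    and "circle_avg (\<lambda>s. C + N * barrier t d (l * (p + of_real r * exp (\<i> * of_real s) - a)))
      = C + N * barrier t d (l * (p - a)) - N * r^2 / 2"
proof -
  define x where "x = Re (l * (p - a))"
  define y where "y = Im (l * (p - a))"
  \<comment> \<open>The gradient of \<open>barrier\<close> at the centre,
    \<open>(3 * t - 4 * x, 2 * y)\<close>, gives \<open>A\<close>. For \<open>norm W = 1\<close> the
    second-order term \<open>(Im W)^2 - 2 * (Re W)^2\<close> equals
    \<open>- 1 / 2 - 3 / 2 * Re (W^2)\<close>, which gives \<open>B\<close> and the loss in the
    constant term.\<close>
  define A where "A = Complex (N * r * (3 * t - 4 * x)) (- 2 * N * r * y) * l"
  define B where "B = of_real (- (3 / 2) * N * r^2) * l^2"
  have "C + N * barrier t d (l * (p + of_real r * exp (\<i> * of_real s) - a)) =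
    (C + N * barrier t d (l * (p - a)) - N * r^2 / 2) + Re (A * exp (\<i> * of_real s)) + Re (B * exp (\<i> * of_real s) ^ 2)" for s
  proof -
    define W where "W = l * exp (\<i> * of_real s)"
    have "norm W = 1" using l by (simp add: W_def norm_mult)
    then have W: "(Im W)^2 = 1 - (Re W)^2"
      by (metis add_diff_cancel_left' cmod_power2 one_power2)
    have 1: "l * (p + of_real r * exp (\<i> * of_real s) - a) = l * (p - a) + of_real r * W"
      by (simp add: W_def algebra_simps)
    have 2: "A * exp (\<i> * of_real s) = Complex (N * r * (3 * t - 4 * x)) (- 2 * N * r * y) * W"
      by (simp add: A_def W_def)
    have 3: "B * exp (\<i> * of_real s) ^ 2 = of_real (- (3 / 2) * N * r^2) * W^2"
      by (simp add: B_def W_def power_mult_distrib)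
    have 4: "Re (W^2) = 2 * (Re W)^2 - 1" using W by (simp add: power2_eq_square)
    have 5: "(y + r * Im W)^2 = y^2 + 2 * y * r * Im W + r^2 * (1 - (Re W)^2)"
      unfolding W[symmetric] by (simp add: power2_eq_square algebra_simps)
    have "Re (of_real (- (3 / 2) * N * r^2) * W^2) = - (3 / 2) * N * r^2 * (2 * (Re W)^2 - 1)"
      using 4 by (metis Re_complex_of_real Im_complex_of_real mult_zero_left diff_zero times_complex.simps(1))
    moreover have "Re (l * (p - a) + of_real r * W) = x + r * Re W" "Im (l * (p - a) + of_real r * W) = y + r * Im W"
      by (simp_all add: x_def y_def)
    moreover have "Re (Complex (N * r * (3 * t - 4 * x)) (- 2 * N * r * y) * W) = N * r * (3 * t - 4 * x) * Re W + 2 * N * r * y * Im W"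
      by simp
    ultimately show ?thesis
      unfolding 1 2 3 barrier_def x_def[symmetric] y_def[symmetric] 5
      by (simp only: 5) (simp add: power2_eq_square field_simps)
  qed
  then show "circle_integrable (\<lambda>s. C + N * barrier t d (l * (p + of_real r * exp (\<i> * of_real s) - a)))"
    "circle_avg (\<lambda>s. C + N * barrier t d (l * (p + of_real r * exp (\<i> * of_real s) - a)))
      = C + N * barrier t d (l * (p - a)) - N * r^2 / 2"
    using circle_avg_trig by presburger+
qed

lemma barrier_bounds:
  assumes n: "norm w \<le> t" and d: "0 \<le> d" "d \<le> t / 20"
    and w: "Re w \<ge> - d \<or> (Im w)^2 \<ge> 40 * t * (- d - Re w)"
  shows "barrier t d w \<ge> 0" and "norm w = t \<Longrightarrow> barrier t d w \<ge> t^2 / 2"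
proof -
  define x where "x = Re w"
  define y where "y = Im w"
  have t: "t \<ge> 0" using n norm_ge_zero order_trans by blast
  have x: "\<bar>x\<bar> \<le> t" and y: "\<bar>y\<bar> \<le> t" using n abs_Re_le_cmod abs_Im_le_cmod x_def y_def order_trans by blast+
  have dd: "d^2 \<le> (t / 20)^2" using d by (intro power_mono) auto
  have "barrier t d w \<ge> 0 \<and> (norm w = t \<longrightarrow> barrier t d w \<ge> t^2 / 2)"
  proof (cases "x \<ge> - d")
    case True
    \<comment> \<open>The second inequality serves the outer circle, where
      \<open>y^2 = t^2 - x^2\<close> contributes one more \<open>- x^2\<close>.\<close>
    have "-2 * x^2 + 4 * d^2 + 3 * t * (x + d) \<ge> 0 \<and> -3 * x^2 + 4 * d^2 + 3 * t * (x + d) \<ge> 0"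
    proof (cases "x \<ge> 0")
      case x0: True
      have "x * x \<le> t * x" using x x0 by (intro mult_right_mono) auto
      moreover have "t * d \<ge> 0" "x * x \<ge> 0" "d * d \<ge> 0" using t d by auto
      ultimately show ?thesis unfolding power2_eq_square distrib_left mult.assoc by linarith
    next
      case False
      have "x^2 \<le> d^2" using True False by (intro power2_le_iff_abs_le[THEN iffD2]) (use d in auto)
      moreover have "t * (x + d) \<ge> 0" using t True by auto
      moreover have "d^2 \<ge> 0" by simp
      ultimately show ?thesis unfolding distrib_left mult.assoc by linarith
    qed
    moreover have "norm w = t \<Longrightarrow> y^2 = t^2 - x^2" unfolding x_def y_def by (metis add_diff_cancel_left' cmod_power2)
    ultimately show ?thesis unfolding barrier_def x_def[symmetric] y_def[symmetric]
      using zero_le_power2[of y] zero_le_power2[of t] by (intro conjI impI) linarith+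
  next
    case False
    \<comment> \<open>\<open>e\<close> is the depth beyond the line. The term \<open>4 * d^2\<close>
      cancels the part of \<open>2 * x^2\<close> due to \<open>d\<close>; what remains negative is
      of order \<open>t * e\<close>, which the hypothesis bounds by \<open>y^2 / 40\<close>.\<close>
    define e where "e = - d - x"
    have e: "e > 0" using False by (simp add: e_def)
    have ye: "y^2 \<ge> 40 * (t * e)" using w False by (simp add: x_def y_def e_def mult.assoc)
    have yt: "y^2 \<le> t * t" using y t by (metis abs_le_square_iff abs_of_nonneg power2_eq_square)
    have et: "e \<le> t / 40"
    proof (cases "t = 0")
      case True then show ?thesis using x d e by (auto simp: e_def)
    next
      case False
      then have "t > 0" using t by simp
      have "t * (40 * e) \<le> t * t" using ye yt by simp
      then show ?thesis using \<open>t > 0\<close> by simp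
    qed
    have ee: "e^2 \<le> t * e / 40" using mult_right_mono[OF et] e by (simp add: power2_eq_square)
    have ee2: "t * e \<le> t^2 / 40" using mult_left_mono[OF et t] by (simp add: power2_eq_square)
    have x2: "x^2 \<le> 2 * d^2 + 2 * e^2"
      using zero_le_power2[of "d - e"] by (simp add: e_def power2_eq_square algebra_simps)
    have te: "t * e \<ge> 0" using t e by simp
    have b: "barrier t d w = y^2 - 2 * x^2 + 4 * d^2 - 3 * (t * e)"
      unfolding barrier_def x_def[symmetric] y_def[symmetric] by (simp add: e_def algebra_simps)
    have "barrier t d w \<ge> 0" using b ye x2 ee te by linarith
    moreover have "barrier t d w \<ge> t^2 / 2" if "norm w = t"
    proof -
      have "y^2 = t^2 - x^2" using that unfolding x_def y_def by (metis add_diff_cancel_left' cmod_power2)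
      moreover have "d^2 \<le> t^2 / 400" using dd by (simp add: power2_eq_square)
      ultimately show ?thesis using b x2 ee ee2 te zero_le_power2[of t] by linarith
    qed
    ultimately show ?thesis by blast
  qed
  then show "barrier t d w \<ge> 0" and "norm w = t \<Longrightarrow> barrier t d w \<ge> t^2 / 2" by auto
qed

text \<open>The bound \<open>f b + e\<close> spreads along an arc of the circle about 0 through
  \<open>b\<close>. A multiple of \<open>barrier\<close>, added to \<open>f a - 2 * e\<close>,
  dominates \<open>f\<close> on that arc and on a small circle about \<open>a\<close>, yet lies
  below \<open>f a\<close> at \<open>a\<close> itself. The radius \<open>s\<close> precedes
  \<open>f\<close> because the lemma is applied to slices that vary with the remaining
  coordinates.\<close>

lemma subavg_lower_bound_nonzero:
  fixes a :: complex
  assumes a: "a \<noteq> 0" and t0: "t0 > 0" and k: "k > 0"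
  shows "\<exists>s>0. \<forall>f b B e. e > 0 \<longrightarrow> usc_on (cball a t0) (\<lambda>z. ereal (f z)) \<longrightarrow> (\<forall>z\<in>cball a t0. \<bar>f z\<bar> \<le> B) \<longrightarrow>
    subavg_on (cball a t0) f \<longrightarrow> (\<forall>z\<in>cball a t0. f z \<le> f a + e) \<longrightarrow>
    (\<forall>z\<in>cball a t0. \<forall>z'\<in>cball a t0. norm z = norm z' \<longrightarrow> norm (z - z') \<le> k * norm z' \<longrightarrow> f z \<le> f z' + e) \<longrightarrow>
    dist b a < s \<longrightarrow> f b \<ge> f a - 3 * e"
proof -
  \<comment> \<open>The bound \<open>norm a / 100\<close> keeps the circle
    \<open>norm z = norm b\<close> nearly flat at scale \<open>t\<close>;
    \<open>k * norm a / 4\<close> keeps its points within \<open>t\<close> of \<open>a\<close> in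
    rotation range of \<open>b\<close>.\<close>
  define t where "t = min t0 (min (norm a / 100) (k * norm a / 4))"
  have t: "t > 0" "t \<le> t0" "t \<le> norm a / 100" "t \<le> k * norm a / 4"
    using assms by (auto simp: t_def)
  show ?thesis
  proof (intro exI[of _ "t / 20"] conjI allI impI)
    show "t / 20 > 0" using t by simp
    fix f b B and e :: real
    assume e: "e > 0" and u: "usc_on (cball a t0) (\<lambda>z. ereal (f z))" and B: "\<forall>z\<in>cball a t0. \<bar>f z\<bar> \<le> B"
      and f: "subavg_on (cball a t0) f" and up: "\<forall>z\<in>cball a t0. f z \<le> f a + e"
      and rot: "\<forall>z\<in>cball a t0. \<forall>z'\<in>cball a t0. norm z = norm z' \<longrightarrow> norm (z - z') \<le> k * norm z' \<longrightarrow> f z \<le> f z' + e"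
      and b: "dist b a < t / 20"
    show "f b \<ge> f a - 3 * e"
    proof (rule ccontr)
      assume "\<not> f b \<ge> f a - 3 * e"
      then have fb: "f b < f a - 3 * e" by simp
      define \<rho> where "\<rho> = norm b"
      \<comment> \<open>The maximum principle is applied on the part of a disc about \<open>a\<close> that lies on the same side of the
        circle \<open>norm z = norm b\<close> as \<open>a\<close>; rotations transport the bound at \<open>b\<close> along this circle.\<close>
      define sg :: real where "sg = (if norm a \<ge> \<rho> then 1 else -1)"
      define d where "d = sg * (norm a - \<rho>)"
      \<comment> \<open>In the coordinate \<open>l * (z - a)\<close> the positive real axis points
        radially away from the circle, which crosses the real axis at \<open>- d\<close>.\<close>
      define l where "l = of_real (sg / norm a) * cnj a"
      define R where "R = {z \<in> cball a t. sg * (norm z - \<rho>) \<ge> 0}"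
      \<comment> \<open>The factor is fixed by two values: at least \<open>t^2 / 2\<close> for
        \<open>barrier\<close> on the outer circle lifts \<open>q\<close> to \<open>f a + e\<close>,
        while at most \<open>t^2 / 4\<close> at the centre leaves
        \<open>q a \<le> f a - e / 2\<close>.\<close>
      define q where "q z = (f a - 2 * e) + (6 * e / t^2) * barrier t d (l * (z - a))" for z
      have sg: "sg = 1 \<or> sg = -1" by (auto simp: sg_def)
      have l: "norm l = 1" using a sg by (auto simp: l_def norm_mult norm_divide)
      have d0: "d \<ge> 0" by (auto simp: d_def sg_def)
      have "d = \<bar>norm a - norm b\<bar>" by (auto simp: d_def sg_def \<rho>_def)
      then have dt: "d < t / 20" using b norm_triangle_ineq3[of a b] by (simp add: dist_norm norm_minus_commute)
      have \<rho>: "\<rho> \<ge> norm a * 99 / 100" using dt t sg d0 by (auto simp: d_def)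
      have zn: "(norm z)^2 = (norm a + sg * Re (l * (z - a)))^2 + (Im (l * (z - a)))^2" for z
      proof -
        have "norm z = norm (cnj a * z / of_real (norm a))" using a by (simp add: norm_mult norm_divide)
        also have "cnj a * z / of_real (norm a) = of_real (norm a) + of_real sg * (l * (z - a))"
        proof -
          have "cnj a * a = of_real (norm a) * of_real (norm a)"
            using complex_norm_square[of a] by (simp only: power2_eq_square of_real_mult mult.commute[of a])
          then have "cnj a * a / of_real (norm a) = of_real (norm a)" using a by simp
          moreover have "of_real sg * l = cnj a / of_real (norm a)"
            using sg by (elim disjE) (simp_all add: l_def)
          then have "of_real sg * (l * (z - a)) = cnj a / of_real (norm a) * (z - a)"
            by (simp only: mult.assoc[symmetric])
          then have "of_real sg * (l * (z - a)) = cnj a * z / of_real (norm a) - cnj a * a / of_real (norm a)"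
            by (simp add: right_diff_distrib diff_divide_distrib)
          ultimately show ?thesis by simp
        qed
        finally have "norm z = norm (of_real (norm a) + of_real sg * (l * (z - a)))" .
        moreover have "(norm (of_real (norm a) + of_real sg * W))^2 = (norm a + sg * Re W)^2 + (Im W)^2" for W
          using sg by (elim disjE) (simp_all add: cmod_power2)
        ultimately show ?thesis by simp
      qed
      \<comment> \<open>If \<open>sg = 1\<close>, the region lies outside the circle and may reach
        past the line \<open>Re w = - d\<close>; the large radius then gives the quadratic
        alternative. If \<open>sg = -1\<close>, it lies in a disc, which stays on one side of its
        tangent.\<close>
      have wR: "norm (l * (z - a)) \<le> t" "Re (l * (z - a)) \<ge> - d \<or> (Im (l * (z - a)))^2 \<ge> 40 * t * (- d - Re (l * (z - a)))"
        if z: "z \<in> R" for z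
      proof -
        show w: "norm (l * (z - a)) \<le> t" using z l by (simp add: R_def norm_mult dist_norm norm_minus_commute)
        define x where "x = Re (l * (z - a))"
        define y where "y = Im (l * (z - a))"
        have x: "\<bar>x\<bar> \<le> t" using w abs_Re_le_cmod order_trans unfolding x_def by blast
        have zn': "(norm z)^2 = (norm a + sg * x)^2 + y^2" using zn[of z] by (simp add: x_def y_def)
        have "x \<ge> - d \<or> y^2 \<ge> 40 * t * (- d - x)"
        proof (cases "sg = 1")
          case True
          have "\<rho> \<le> norm z" using z True by (simp add: R_def)
          then have "\<rho>^2 \<le> (norm z)^2" by (intro power_mono) (auto simp: \<rho>_def)
          also have "\<dots> = (\<rho> - (- d - x))^2 + y^2" using zn' True by (simp add: d_def)
          finally have yy: "y^2 \<ge> (2 * \<rho> - (- d - x)) * (- d - x)" by (simp add: power2_eq_square algebra_simps)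
          show ?thesis
          proof (cases "x \<ge> - d")
            case False
            have "40 * t \<le> 2 * \<rho> - (- d - x)" using t \<rho> x d0 by linarith
            then have "40 * t * (- d - x) \<le> (2 * \<rho> - (- d - x)) * (- d - x)"
              using False by (intro mult_right_mono) auto
            with yy show ?thesis by linarith
          qed simp
        next
          case False
          then have s: "sg = -1" using sg by simp
          have "\<rho> \<ge> norm z" using z s by (simp add: R_def)
          moreover have "norm a - x \<le> norm z"
          proof (rule power2_le_imp_le)
            show "(norm a - x)^2 \<le> (norm z)^2" unfolding zn' s by simp
          qed simp
          ultimately show ?thesis using s by (simp add: d_def)
        qed
        then show "Re (l * (z - a)) \<ge> - d \<or> (Im (l * (z - a)))^2 \<ge> 40 * t * (- d - Re (l * (z - a)))"
          unfolding x_def y_def .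
      qed
      have N: "6 * e / t^2 > 0" using e t by simp
      have Rsub: "R \<subseteq> cball a t0" using t by (auto simp: R_def)
      have aR: "a \<in> R" using d0 t by (simp add: R_def d_def)
      have "f a \<le> q a"
      proof (rule strict_superharmonic_majorant[OF u _ f _ Rsub])
        show "\<And>z. z \<in> cball a t0 \<Longrightarrow> \<bar>f z\<bar> \<le> B" using B by blast
        have "closed {z. 0 \<le> sg * (norm z - \<rho>)}" by (intro closed_Collect_le continuous_intros)
        moreover have "R = cball a t \<inter> {z. 0 \<le> sg * (norm z - \<rho>)}" by (auto simp: R_def)
        ultimately show "compact R" by (metis compact_Int_closed compact_cball)
        show "continuous_on R q" unfolding q_def barrier_def by (intro continuous_intros)
        show "circle_integrable (\<lambda>s. q (p + of_real r * exp (\<i> * of_real s)))" for p r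
          unfolding q_def by (rule barrier_circle[OF l])
        show "circle_avg (\<lambda>s. q (p + of_real r * exp (\<i> * of_real s))) < q p" if "r > 0" for p r
        proof -
          have "6 * e / t^2 * r^2 > 0" using N that by (intro mult_pos_pos) auto
          then show ?thesis unfolding q_def barrier_circle(2)[OF l] by simp
        qed
        show "a \<in> R" by (rule aR)
        show "f z \<le> q z" if z: "z \<in> R - interior R" for z
        proof -
          have zR: "z \<in> R" using z by simp
          have bb: "barrier t d (l * (z - a)) \<ge> 0" "norm (l * (z - a)) = t \<Longrightarrow> barrier t d (l * (z - a)) \<ge> t^2 / 2"
            using barrier_bounds[OF wR(1)[OF zR] d0 _ wR(2)[OF zR]] dt by auto
          have "norm (l * (z - a)) = t \<or> norm z = \<rho>"
          proof (rule ccontr)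
            assume "\<not> ?thesis"
            then have "norm (z - a) \<noteq> t" "norm z \<noteq> \<rho>" using l by (auto simp: norm_mult)
            then have "z \<in> ball a t \<inter> {z. 0 < sg * (norm z - \<rho>)}"
              using zR sg by (auto simp: R_def dist_norm norm_minus_commute)
            moreover have "open (ball a t \<inter> {z. 0 < sg * (norm z - \<rho>)})"
              by (intro open_Int open_ball open_Collect_less continuous_intros)
            moreover have "ball a t \<inter> {z. 0 < sg * (norm z - \<rho>)} \<subseteq> R" by (auto simp: R_def)
            ultimately have "z \<in> interior R" by (meson interiorI)
            then show False using z by simp
          qed
          then show ?thesis
          proof
            assume "norm (l * (z - a)) = t"
            then have "6 * e / t^2 * barrier t d (l * (z - a)) \<ge> 6 * e / t^2 * (t^2 / 2)"
              using bb N by (intro mult_left_mono) auto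
            then have "q z \<ge> f a + e" using t by (simp add: q_def)
            then show ?thesis using up zR Rsub by fastforce
          next
            assume nz: "norm z = \<rho>"
            have "norm (z - b) \<le> norm (z - a) + norm (b - a)"
              using norm_triangle_ineq4[of "z - a" "b - a"] by simp
            also have "\<dots> \<le> 2 * t" using zR b t by (auto simp: R_def dist_norm norm_minus_commute)
            also have "\<dots> \<le> (k * norm a) * 99 / 100" using t(1,4) by linarith
            also have "\<dots> = k * (norm a * 99 / 100)" by simp
            also have "\<dots> \<le> k * norm b" using \<rho> k by (intro mult_left_mono) (auto simp: \<rho>_def)
            finally have "f z \<le> f b + e"
              using rot zR Rsub b t nz unfolding \<rho>_def by (auto simp: dist_commute)
            also have "\<dots> \<le> f a - 2 * e" using fb by simp
            also have "\<dots> \<le> q z" using mult_nonneg_nonneg[OF less_imp_le[OF N] bb(1)] by (simp add: q_def)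
            finally show ?thesis .
          qed
        qed
      qed
      moreover have "q a < f a"
      proof -
        have "d^2 \<le> (t / 20)^2" using d0 dt by (intro power_mono) auto
        moreover have "t * d \<le> t * (t / 20)" using dt t by (intro mult_left_mono) auto
        moreover have "barrier t d 0 = 4 * d^2 + 3 * (t * d)" by (simp add: barrier_def)
        moreover have "(t / 20)^2 = t^2 / 400" "t * (t / 20) = t^2 / 20" by (simp_all add: power2_eq_square)
        ultimately have "barrier t d 0 \<le> t^2 / 4" using zero_le_power2[of t] by linarith
        then have "6 * e / t^2 * barrier t d 0 \<le> 6 * e / t^2 * (t^2 / 4)" using N by (intro mult_left_mono) auto
        also have "\<dots> = 3 * e / 2" using t by simp
        finally show ?thesis using e by (simp add: q_def)
      qed
      ultimately show False by simp
    qed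
  qed
qed

text \<open>Submean inequality at 0 over the circle through \<open>b\<close>: values are at most
  \<open>f 0 - 2 * e\<close> on an arc of length \<open>k\<close> in the parameter and at most
  \<open>f 0 + d\<close> elsewhere, with \<open>d = e * k / (2 * pi)\<close>. The arc lowers the
  average by at least \<open>2 * d\<close>, more than the excess \<open>d\<close>.\<close>

lemma subavg_lower_bound_zero:
  assumes k: "0 < k" "k \<le> 1" and e: "e > 0" and t0: "t0 > 0"
    and u: "usc_on (cball 0 t0) (\<lambda>z. ereal (f z))" and B: "\<And>z. z \<in> cball 0 t0 \<Longrightarrow> \<bar>f z\<bar> \<le> B"
    and f: "subavg_on (cball 0 t0) f"
    and up: "\<And>z. z \<in> cball 0 t0 \<Longrightarrow> f z \<le> f 0 + e * k / (2 * pi)"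
    and rot: "\<And>z z'. z \<in> cball 0 t0 \<Longrightarrow> z' \<in> cball 0 t0 \<Longrightarrow> norm z = norm z' \<Longrightarrow> norm (z - z') \<le> k * norm z' \<Longrightarrow> f z \<le> f z' + e"
    and b: "norm b \<le> t0"
  shows "f b \<ge> f 0 - 3 * e"
proof (rule ccontr)
  assume "\<not> f b \<ge> f 0 - 3 * e"
  then have fb: "f b < f 0 - 3 * e" by simp
  define r where "r = norm b"
  have r: "r > 0" using fb e by (auto simp: r_def)
  let ?c = "\<lambda>t. 0 + of_real r * exp (\<i> * of_real t)"
  define t where "t = Arg2pi b"
  have t: "0 \<le> t" "t < 2 * pi" "b = ?c t"
    using Arg2pi_eq[of b] Arg2pi_ge_0[of b] Arg2pi_lt_2pi[of b] by (auto simp: t_def r_def)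
  \<comment> \<open>The interval of length \<open>k\<close> starts or ends at \<open>t\<close>, so
    that it stays in \<open>{0..2 * pi}\<close> instead of wrapping around.\<close>
  define t1 where "t1 = (if t \<le> pi then t else t - k)"
  have t1: "0 \<le> t1" "t1 + k \<le> 2 * pi" "t1 \<le> t" "t \<le> t1 + k"
    using t k pi_ge_two by (auto simp: t1_def)
  define d where "d = e * k / (2 * pi)"
  have d: "d \<ge> 0" "d < e" using e k pi_ge_two by (auto simp: d_def field_simps intro!: mult_strict_left_mono)
  define g where "g s = f 0 + d - (2 * e + d) * indicator {t1..t1 + k} s" for s :: real
  have cball: "?c s \<in> cball 0 t0" for s using r b by (simp add: norm_mult r_def)
  interpret finite_measure "restrict_space lborel {0..2 * pi}" by (rule finite_measure_arc)
  have ig: "circle_integrable (indicator {t1..t1 + k})"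
    by (rule circle_integrable_borel_bounded[of _ 1]) (auto simp: indicator_def intro!: measurable_restrict_space1)
  then have ig': "circle_integrable g" unfolding g_def[abs_def] by (intro Bochner_Integration.integrable_diff) auto
  have "f 0 \<le> circle_avg (\<lambda>s. f (?c s))" using f r b unfolding subavg_on_def r_def by (metis zero_less_norm_iff subset_cball)
  also have "\<dots> \<le> circle_avg g"
  proof (rule circle_avg_mono[OF _ ig'])
    show "circle_integrable (\<lambda>s. f (?c s))"
      using r b by (intro circle_integrable_usc_cball[OF u B]) (auto simp: r_def)
    show "f (?c s) \<le> g s" for s
    proof (cases "s \<in> {t1..t1 + k}")
      case True
      have "norm (?c s - b) = r * norm (exp (\<i> * of_real s) - exp (\<i> * of_real t))"
        using r by (simp add: t(3) norm_mult right_diff_distrib[symmetric] del: right_diff_distrib_numeral)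
      also have "\<dots> \<le> r * k"
      proof (rule mult_left_mono)
        have "norm (exp (\<i> * of_real s) - exp (\<i> * of_real t)) = 2 * \<bar>sin ((s - t) / 2)\<bar>"
        proof -
          have "exp (\<i> * of_real s) - exp (\<i> * of_real t) = exp (\<i> * of_real t) * (exp (\<i> * of_real (s - t)) - 1)"
            by (simp add: right_diff_distrib exp_diff)
          then show ?thesis by (simp add: norm_mult dist_exp_i_1 del: of_real_diff)
        qed
        also have "\<dots> \<le> 2 * \<bar>(s - t) / 2\<bar>" using abs_sin_x_le_abs_x[of "(s - t) / 2"] by (intro mult_left_mono) simp_all
        also have "\<dots> \<le> k" using True t1 by auto
        finally show "norm (exp (\<i> * of_real s) - exp (\<i> * of_real t)) \<le> k" .
      qed (use r in auto)
      finally have "f (?c s) \<le> f b + e"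
        using rot[OF cball, of b s] b r by (simp add: norm_mult r_def mult.commute)
      also have "\<dots> \<le> f 0 - 2 * e" using fb by simp
      finally show ?thesis using True by (simp add: g_def)
    next
      case False
      then show ?thesis using up[OF cball, of s] by (simp add: g_def d_def)
    qed
  qed
  also have "circle_avg g = f 0 + d - (2 * e + d) * (k / (2 * pi))"
  proof -
    have "(LINT s|restrict_space lborel {0..2 * pi}. indicator {t1..t1 + k} s) = k"
      using t1 k by (simp add: measure_restrict_space)
    then have "circle_avg (indicator {t1..t1 + k}) = k / (2 * pi)" by (simp add: circle_avg_def)
    moreover have "circle_avg g = circle_avg (\<lambda>_. f 0 + d) - (2 * e + d) * circle_avg (indicator {t1..t1 + k})"
      unfolding g_def[abs_def] circle_avg_def using ig by (simp add: diff_divide_distrib)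
    ultimately show ?thesis by simp
  qed
  also have "\<dots> < f 0"
  proof -
    have "(2 * e + d) * (k / (2 * pi)) = 2 * d + d * (k / (2 * pi))" by (simp add: d_def field_simps)
    moreover have "d * (k / (2 * pi)) \<ge> 0" "d > 0" using d k e by (auto simp: d_def)
    ultimately show ?thesis by linarith
  qed
  finally show False by simp
qed

subsection \<open>The envelope\<close>

text \<open>A reverse Fatou argument for circles with converging centres, where semicontinuity
  controls the limit only from one side.\<close>

lemma circle_avg_usc_limit:
  fixes g :: "nat \<Rightarrow> real \<Rightarrow> real"
  assumes i: "\<And>n. circle_integrable (g n)" "circle_integrable h"
    and B: "\<And>n t. t \<in> {0..2 * pi} \<Longrightarrow> \<bar>g n t\<bar> \<le> B" "\<And>t. t \<in> {0..2 * pi} \<Longrightarrow> \<bar>h t\<bar> \<le> B"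
    and lim: "\<And>t c. t \<in> {0..2 * pi} \<Longrightarrow> h t < c \<Longrightarrow> \<forall>\<^sub>F n in sequentially. g n t < c"
    and A: "\<And>n. A \<le> circle_avg (g n)"
  shows "A \<le> circle_avg h"
proof -
  interpret finite_measure "restrict_space lborel {0..2 * pi}" by (rule finite_measure_arc)
  let ?S = "restrict_space lborel {0..2 * pi}"
  \<comment> \<open>Passing to the maximum turns the one-sided convergence into pointwise convergence.\<close>
  define k where "k n t = max (g n t) (h t)" for n t
  have ik: "circle_integrable (k n)" for n unfolding k_def[abs_def] using i by (intro Bochner_Integration.integrable_max)
  have "(\<lambda>n. integral\<^sup>L ?S (k n)) \<longlonglongrightarrow> integral\<^sup>L ?S h"
  proof (rule integral_dominated_convergence[where w = "\<lambda>_. B"])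
    show "h \<in> borel_measurable ?S" "k n \<in> borel_measurable ?S" for n using i ik by auto
    show "AE t in ?S. (\<lambda>n. k n t) \<longlonglongrightarrow> h t"
    proof (rule AE_I2)
      fix t assume t: "t \<in> space ?S"
      show "(\<lambda>n. k n t) \<longlonglongrightarrow> h t"
      proof (rule order_tendstoI)
        fix c assume "h t < c"
        then show "\<forall>\<^sub>F n in sequentially. k n t < c"
          using lim[of t c] t by (simp add: k_def)
      qed (auto simp: k_def less_max_iff_disj)
    qed
    show "AE t in ?S. norm (k n t) \<le> B" for n
      using B(1)[of _ n] B(2) by (intro AE_I2) (auto simp: k_def max_def)
  qed simp
  then have "(\<lambda>n. circle_avg (k n)) \<longlonglongrightarrow> circle_avg h"
    unfolding circle_avg_def by (intro tendsto_intros) auto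
  moreover have "A \<le> circle_avg (k n)" for n
    using A[of n] circle_avg_mono[OF i(1) ik, of n n] by (fastforce simp: k_def)
  ultimately show ?thesis by (intro LIMSEQ_le_const) auto
qed

section \<open>Submean inequality along complex lines\<close>

lemma continuous_on_complex_line: "continuous_on S g \<Longrightarrow> continuous_on S (\<lambda>x. a + g x *s b)"
  for b :: "complex ^ 'n"
  unfolding vector_scalar_mult_def by (intro continuous_intros)

text \<open>All discs are centred at the parameter 0: by \<open>complex_line_shift\<close> another
  centre only changes the base point \<open>z\<close>.\<close>

definition subavg_lines :: "(complex ^ 'n) set \<Rightarrow> (complex ^ 'n \<Rightarrow> real) \<Rightarrow> bool" where
  "subavg_lines \<Omega> f \<longleftrightarrow>
     (\<forall>z b r. r > 0 \<and> (\<forall>\<zeta>\<in>cball 0 r. z + \<zeta> *s b \<in> \<Omega>) \<longrightarrow>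
        f z \<le> circle_avg (\<lambda>t. f (z + (of_real r * exp (\<i> * of_real t)) *s b)))"

lemma circle_integrable_line:
  fixes f :: "complex ^ 'n \<Rightarrow> real"
  assumes u: "usc_on \<Omega> (\<lambda>z. ereal (f z))" and B: "\<And>z. z \<in> \<Omega> \<Longrightarrow> \<bar>f z\<bar> \<le> B"
    and r: "r \<ge> 0" "\<And>\<zeta>. \<zeta> \<in> cball 0 r \<Longrightarrow> z + \<zeta> *s b \<in> \<Omega>"
  shows "circle_integrable (\<lambda>t. f (z + (of_real r * exp (\<i> * of_real t)) *s b))"
proof (rule circle_integrable_usc[OF u B])
  show "continuous_on {0..2 * pi} (\<lambda>t. z + (of_real r * exp (\<i> * of_real t)) *s b)"
    by (intro continuous_on_complex_line continuous_intros)
  show "(\<lambda>t. z + (of_real r * exp (\<i> * of_real t)) *s b) ` {0..2 * pi} \<subseteq> \<Omega>"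
    using r circle_in_cball[of r 0] by auto
qed

lemma complex_line_shift: "a + (p + \<zeta>) *s b = (a + p *s b) + \<zeta> *s b" for b :: "complex ^ 'n"
  by (simp add: vec_eq_iff algebra_simps)

lemma subavg_lines_line:
  assumes "subavg_lines \<Omega> f" "\<And>\<zeta>. \<zeta> \<in> D \<Longrightarrow> a + \<zeta> *s b \<in> \<Omega>"
  shows "subavg_on D (\<lambda>\<zeta>. f (a + \<zeta> *s b))"
  unfolding subavg_on_def
proof (intro allI impI)
  fix p r assume r: "r > 0 \<and> cball p r \<subseteq> D"
  have "(a + p *s b) + \<zeta> *s b \<in> \<Omega>" if "\<zeta> \<in> cball 0 r" for \<zeta>
  proof -
    have "p + \<zeta> \<in> cball p r" using that by (simp add: dist_norm)
    then show ?thesis using assms(2) r by (metis complex_line_shift subsetD)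
  qed
  then show "f (a + p *s b) \<le> circle_avg (\<lambda>t. f (a + (p + of_real r * exp (\<i> * of_real t)) *s b))"
    using assms(1) r unfolding subavg_lines_def complex_line_shift by blast
qed

text \<open>Boundedness and semicontinuity make the circle means real. The competitors constructed
  below (a constant, \<open>reg\<close>, a rotated envelope minus a constant) all come from this
  lemma.\<close>

lemma psh_on_ereal:
  fixes f :: "complex ^ 'n \<Rightarrow> real"
  assumes u: "usc_on \<Omega> (\<lambda>z. ereal (f z))" and B: "\<And>z. z \<in> \<Omega> \<Longrightarrow> \<bar>f z\<bar> \<le> B"
    and f: "subavg_lines \<Omega> f"
  shows "psh_on \<Omega> (\<lambda>z. ereal (f z))"
  unfolding psh_on_def subharmonic_on_def
proof (intro conjI allI ballI impI)
  fix a b :: "complex ^ 'n"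
  let ?D = "{\<zeta>. a + \<zeta> *s b \<in> \<Omega>}"
  show uD: "usc_on ?D (\<lambda>\<zeta>. ereal (f (a + \<zeta> *s b)))"
    by (rule usc_on_compose[OF u]) (auto intro!: continuous_on_complex_line continuous_intros)
  fix p r assume r: "0 < r \<and> cball p r \<subseteq> ?D"
  have "f (a + p *s b) \<le> circle_avg (\<lambda>t. f (a + (p + of_real r * exp (\<i> * of_real t)) *s b))"
    using subavg_lines_line[OF f, of ?D a b] r unfolding subavg_on_def by auto
  also have "ereal \<dots> = circle_mean (\<lambda>\<zeta>. ereal (f (a + \<zeta> *s b))) p r"
    using r B by (intro circle_mean_ereal[symmetric] circle_integrable_usc_cball[OF uD]) auto
  finally show "ereal (f (a + p *s b)) \<le> circle_mean (\<lambda>\<zeta>. ereal (f (a + \<zeta> *s b))) p r" by simp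
qed (use u in auto)

lemma psh_on_submean:
  assumes u: "psh_on \<Omega> u" and r: "r > 0" "\<And>\<zeta>. \<zeta> \<in> cball 0 r \<Longrightarrow> z + \<zeta> *s b \<in> \<Omega>"
  shows "u z \<le> circle_mean (\<lambda>\<zeta>. u (z + \<zeta> *s b)) 0 r"
proof -
  have "cball 0 r \<subseteq> {\<zeta>. z + \<zeta> *s b \<in> \<Omega>}" using r by auto
  then have "u (z + 0 *s b) \<le> circle_mean (\<lambda>\<zeta>. u (z + \<zeta> *s b)) 0 r"
    using u r(1) unfolding psh_on_def subharmonic_on_def by blast
  then show ?thesis by simp
qed

text \<open>Symmetry of the domain is kept out of the locale and enters as an assumption of single
  lemmas such as \<open>env_rot_le\<close>. The explicit \<open>M\<close> is the uniform bound for
  dominated convergence.\<close>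

locale perron_obstacle =
  fixes \<Omega> :: "(complex ^ 'n) set" and \<phi> :: "complex ^ 'n \<Rightarrow> real" and M :: real
  assumes open_domain: "open \<Omega>" and obstacle_bound: "\<And>z. z \<in> \<Omega> \<Longrightarrow> \<bar>\<phi> z\<bar> \<le> M"
    and obstacle_continuous: "continuous_on \<Omega> \<phi>"
begin

definition env_ext where "env_ext = Perron_Bremermann \<Omega> \<phi>"

text \<open>Infinite values would become 0 under \<open>real_of_ereal\<close>; by
  \<open>env_ext_ereal\<close> nothing is lost on \<open>\<Omega>\<close>.\<close>

definition env where "env z = real_of_ereal (env_ext z)"

lemma competitor_le:
  assumes "psh_on \<Omega> u" "\<And>w. w \<in> \<Omega> \<Longrightarrow> u w \<le> ereal (\<phi> w)"
  shows "u z \<le> env_ext z"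
  unfolding env_ext_def Perron_Bremermann_def using assms
  by (intro SUP_upper) (auto simp: usc_regularization_eq psh_on_def)

lemma env_ext_le:
  assumes z: "z \<in> \<Omega>" shows "env_ext z \<le> ereal (\<phi> z)"
  unfolding env_ext_def Perron_Bremermann_def
proof (rule SUP_least)
  fix u assume "u \<in> {u. psh_on \<Omega> u \<and> (\<forall>w\<in>\<Omega>. usc_regularization \<Omega> u w \<le> ereal (\<phi> w))}"
  then show "u z \<le> ereal (\<phi> z)" using z usc_regularization_eq[of \<Omega> u z] by (auto simp: psh_on_def)
qed

lemma env_ext_ge:
  assumes z: "z \<in> \<Omega>" shows "env_ext z \<ge> ereal (- M)"
proof (rule competitor_le)
  show "psh_on \<Omega> (\<lambda>_. ereal (- M))"
    by (rule psh_on_ereal[of _ _ "\<bar>M\<bar>"]) (auto simp: subavg_lines_def usc_on_eventually)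
  show "ereal (- M) \<le> ereal (\<phi> w)" if "w \<in> \<Omega>" for w using obstacle_bound[OF that] by auto
qed

lemma env_ext_ereal: "z \<in> \<Omega> \<Longrightarrow> env_ext z = ereal (env z)"
  using env_ext_le[of z] env_ext_ge[of z] unfolding env_def by (cases "env_ext z") auto

lemma env_le: "z \<in> \<Omega> \<Longrightarrow> env z \<le> \<phi> z"
  using env_ext_le[of z] env_ext_ereal by auto

lemma env_bound: "z \<in> \<Omega> \<Longrightarrow> \<bar>env z\<bar> \<le> M"
  using env_ext_le[of z] env_ext_ge[of z] obstacle_bound[of z] env_ext_ereal[of z] by (auto simp: abs_le_iff)

section \<open>Regularization of the envelope\<close>

definition reg_ext where "reg_ext = usc_regularization \<Omega> env_ext"

definition reg where "reg z = real_of_ereal (reg_ext z)"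

lemma env_ext_le_reg_ext:
  assumes z: "z \<in> \<Omega>" shows "env_ext z \<le> reg_ext z"
  unfolding reg_ext_def usc_regularization_def Limsup_def le_INF_iff
proof clarsimp
  fix E assume "eventually E (inf (nhds z) (principal \<Omega>))"
  then have "E z" using z by (auto simp: eventually_inf_principal eventually_nhds)
  then show "env_ext z \<le> Sup (env_ext ` Collect E)" by (auto intro: SUP_upper)
qed

lemma reg_ext_le_if:
  assumes "open T" "z \<in> T" "\<And>y. y \<in> T \<Longrightarrow> y \<in> \<Omega> \<Longrightarrow> env_ext y \<le> c"
  shows "reg_ext z \<le> c"
proof -
  have "\<forall>\<^sub>F y in inf (nhds z) (principal \<Omega>). env_ext y \<le> c"
    unfolding eventually_inf_principal eventually_nhds using assms by blast
  then show ?thesis unfolding reg_ext_def usc_regularization_def by (rule Limsup_bounded)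
qed

lemma reg_ext_le:
  assumes z: "z \<in> \<Omega>" shows "reg_ext z \<le> ereal (\<phi> z)"
proof (rule ereal_le_epsilon2)
  fix e :: real assume e: "0 < e"
  obtain T where T: "open T" "T \<inter> \<Omega> = \<phi> -` {..<\<phi> z + e} \<inter> \<Omega>"
    using continuous_on_open_invariant[THEN iffD1, OF obstacle_continuous, rule_format, of "{..<\<phi> z + e}"] by auto
  have "reg_ext z \<le> ereal (\<phi> z + e)"
  proof (rule reg_ext_le_if[OF T(1)])
    show "z \<in> T" using T z e by auto
    fix y assume "y \<in> T" "y \<in> \<Omega>"
    then have "\<phi> y < \<phi> z + e" using T by auto
    with env_ext_le[OF \<open>y \<in> \<Omega>\<close>] show "env_ext y \<le> ereal (\<phi> z + e)"
      by (meson ereal_less_eq(3) less_imp_le order_trans)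
  qed
  then show "reg_ext z \<le> ereal (\<phi> z) + ereal e" by simp
qed

lemma reg_ext_ereal: "z \<in> \<Omega> \<Longrightarrow> reg_ext z = ereal (reg z)"
  using reg_ext_le[of z] env_ext_le_reg_ext[of z] env_ext_ge[of z] unfolding reg_def by (cases "reg_ext z") auto

lemma reg_bound: "z \<in> \<Omega> \<Longrightarrow> \<bar>reg z\<bar> \<le> M"
  using reg_ext_le[of z] env_ext_le_reg_ext[of z] env_ext_ge[of z] obstacle_bound[of z] reg_ext_ereal[of z] env_ext_ereal[of z] by (auto simp: abs_le_iff)

lemma usc_reg: "usc_on \<Omega> (\<lambda>z. ereal (reg z))"
  unfolding usc_on_eventually
proof (intro ballI allI impI)
  fix z c assume z: "z \<in> \<Omega>" and c: "ereal (reg z) < c"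
  \<comment> \<open>The intermediate \<open>d\<close> absorbs the weakening of \<open><\<close> to
    \<open>\<le>\<close> under the upper limit.\<close>
  then obtain d where d: "reg_ext z < d" "d < c" using dense reg_ext_ereal by metis
  then have "\<forall>\<^sub>F y in inf (nhds z) (principal \<Omega>). env_ext y < d"
    unfolding reg_ext_def usc_regularization_def by (intro Limsup_lessD)
  then obtain T where T: "open T" "z \<in> T" "\<And>y. y \<in> T \<Longrightarrow> y \<in> \<Omega> \<Longrightarrow> env_ext y < d"
    unfolding eventually_inf_principal eventually_nhds by blast
  have "ereal (reg y) < c" if "y \<in> T" "y \<in> \<Omega>" for y
  proof -
    have "reg_ext y \<le> d" by (rule reg_ext_le_if[OF T(1) that(1)]) (auto dest!: T(3))
    then show ?thesis using d reg_ext_ereal that by auto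
  qed
  then show "\<forall>\<^sub>F y in at z within \<Omega>. ereal (reg y) < c"
    unfolding eventually_at_topological using T by blast
qed

text \<open>At points \<open>Y n\<close> tending to \<open>z\<close> some competitor exceeds
  \<open>reg z - e\<close>. Its submean inequality bounds \<open>reg z - e\<close> by the average of
  \<open>reg\<close> over a translated circle, and the limit leads back to the circle about
  \<open>z\<close>.\<close>

lemma subavg_reg: "subavg_lines \<Omega> reg"
  unfolding subavg_lines_def
proof (intro allI impI, elim conjE)
  fix z b :: "complex ^ 'n" and r :: real
  assume r: "r > 0" and K: "\<forall>\<zeta>\<in>cball 0 r. z + \<zeta> *s b \<in> \<Omega>"
  let ?c = "\<lambda>t. of_real r * exp (\<i> * of_real t)"
  have z: "z \<in> \<Omega>" using K[rule_format, of 0] r by simp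
  \<comment> \<open>Compactness of the disc gives one \<open>\<delta>\<close> such that all its
    translates by less than \<open>\<delta>\<close> stay in \<open>\<Omega>\<close>.\<close>
  have "compact ((\<lambda>\<zeta>. z + \<zeta> *s b) ` cball 0 r)"
    by (intro compact_continuous_image continuous_on_complex_line continuous_intros) auto
  then obtain \<delta> where \<delta>: "\<delta> > 0" "(\<Union>x\<in>(\<lambda>\<zeta>. z + \<zeta> *s b) ` cball 0 r. ball x \<delta>) \<subseteq> \<Omega>"
    using compact_subset_open_imp_ball_epsilon_subset[OF _ open_domain] K by (metis image_subsetI)
  have near: "y + \<zeta> *s b \<in> \<Omega>" if "dist y z < \<delta>" "\<zeta> \<in> cball 0 r" for y \<zeta>
  proof -
    have "y + \<zeta> *s b \<in> ball (z + \<zeta> *s b) \<delta>" using that(1) by (simp add: dist_commute)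
    then show ?thesis using \<delta>(2) that(2) by blast
  qed
  show "reg z \<le> circle_avg (\<lambda>t. reg (z + ?c t *s b))"
  proof (rule field_le_epsilon)
    fix e :: real assume e: "e > 0"
    have "\<exists>y\<in>\<Omega>. dist y z < min \<delta> (1 / Suc n) \<and> env_ext y > ereal (reg z - e)" for n
    proof (rule ccontr)
      assume *: "\<not> ?thesis"
      have "reg_ext z \<le> ereal (reg z - e)"
      proof (rule reg_ext_le_if[of "ball z (min \<delta> (1 / Suc n))"])
        show "z \<in> ball z (min \<delta> (1 / Suc n))" using \<delta> by simp
        fix y assume "y \<in> ball z (min \<delta> (1 / Suc n))" "y \<in> \<Omega>"
        then show "env_ext y \<le> ereal (reg z - e)" using * by (metis dist_commute mem_ball not_le)
      qed simp
      then show False using reg_ext_ereal[OF z] e by simp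
    qed
    then obtain Y where Y: "\<And>n. Y n \<in> \<Omega>" "\<And>n. dist (Y n) z < min \<delta> (1 / Suc n)" "\<And>n. env_ext (Y n) > ereal (reg z - e)"
      by metis
    have YK: "Y n + \<zeta> *s b \<in> \<Omega>" if "\<zeta> \<in> cball 0 r" for n \<zeta> using near Y(2)[of n] that by auto
    have cK: "?c t \<in> cball 0 r" for t using r by (simp add: norm_mult)
    have "Y \<longlonglongrightarrow> z"
      unfolding tendsto_dist_iff[of Y]
    proof (rule tendsto_sandwich[OF _ _ tendsto_const LIMSEQ_inverse_real_of_nat])
      show "\<forall>\<^sub>F n in sequentially. 0 \<le> dist (Y n) z" by simp
      have "dist (Y n) z \<le> inverse (real (Suc n))" for n
        using Y(2)[of n] by (simp add: inverse_eq_divide)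
      then show "\<forall>\<^sub>F n in sequentially. dist (Y n) z \<le> inverse (real (Suc n))" by simp
    qed
    have "reg z - e \<le> circle_avg (\<lambda>t. reg (z + ?c t *s b))"
    proof (rule circle_avg_usc_limit[where g = "\<lambda>n t. reg (Y n + ?c t *s b)" and B = M])
      show i: "circle_integrable (\<lambda>t. reg (Y n + ?c t *s b))" for n
        using r by (intro circle_integrable_line[OF usc_reg reg_bound] YK) auto
      show "circle_integrable (\<lambda>t. reg (z + ?c t *s b))"
        using r K by (intro circle_integrable_line[OF usc_reg reg_bound]) auto
      show "\<bar>reg (Y n + ?c t *s b)\<bar> \<le> M" "\<bar>reg (z + ?c t *s b)\<bar> \<le> M" for n t
        using cK YK K by (auto intro!: reg_bound simp del: mem_cball)
      show "\<forall>\<^sub>F n in sequentially. reg (Y n + ?c t *s b) < c" if "reg (z + ?c t *s b) < c" for t c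
      proof -
        have "z + ?c t *s b \<in> \<Omega>" using K cK by blast
        then have "\<forall>\<^sub>F y in nhds (z + ?c t *s b). y \<in> \<Omega> \<and> ereal (reg y) < ereal c"
        proof -
          have "open {y \<in> \<Omega>. ereal (reg y) < ereal c}"
            using usc_reg unfolding usc_on_def openin_open_eq[OF open_domain] by blast
          with \<open>z + ?c t *s b \<in> \<Omega>\<close> that show ?thesis
            unfolding eventually_nhds by (intro exI[of _ "{y \<in> \<Omega>. ereal (reg y) < ereal c}"]) simp
        qed
        moreover have "(\<lambda>n. Y n + ?c t *s b) \<longlonglongrightarrow> z + ?c t *s b"
          by (intro tendsto_add \<open>Y \<longlonglongrightarrow> z\<close> tendsto_const)
        ultimately show ?thesis
          unfolding filterlim_iff by (auto elim!: allE eventually_mono)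
      qed
      show "reg z - e \<le> circle_avg (\<lambda>t. reg (Y n + ?c t *s b))" for n
      proof -
        obtain u where u: "psh_on \<Omega> u" "\<And>w. w \<in> \<Omega> \<Longrightarrow> usc_regularization \<Omega> u w \<le> ereal (\<phi> w)"
          and uY: "ereal (reg z - e) < u (Y n)"
          using Y(3)[of n] unfolding env_ext_def Perron_Bremermann_def less_SUP_iff by blast
        have uQ: "u w \<le> ereal (reg w)" if w: "w \<in> \<Omega>" for w
        proof -
          have "u w \<le> env_ext w" using u by (intro competitor_le) (auto simp: psh_on_def usc_regularization_eq)
          then show ?thesis using env_ext_le_reg_ext[OF w] reg_ext_ereal[OF w] by (metis order_trans)
        qed
        note uY
        also have "u (Y n) \<le> circle_mean (\<lambda>\<zeta>. u (Y n + \<zeta> *s b)) 0 r"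
          by (rule psh_on_submean[OF u(1) r YK])
        also have "\<dots> \<le> circle_mean (\<lambda>\<zeta>. ereal (reg (Y n + \<zeta> *s b))) 0 r"
          using cK YK by (intro circle_mean_mono uQ) simp
        also have "\<dots> = ereal (circle_avg (\<lambda>t. reg (Y n + ?c t *s b)))"
          using circle_mean_ereal[of "\<lambda>\<zeta>. reg (Y n + \<zeta> *s b)" 0 r] i[of n] by simp
        finally show ?thesis by simp
      qed
    qed
    then show "reg z \<le> circle_avg (\<lambda>t. reg (z + ?c t *s b)) + e" by simp
  qed
qed

text \<open>\<open>reg\<close> is itself a competitor, so it cannot exceed the supremum. The
  envelope thereby inherits semicontinuity and the submean inequality.\<close>

lemma reg_eq_env:
  assumes z: "z \<in> \<Omega>" shows "reg z = env z"
proof -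
  have "ereal (reg z) \<le> env_ext z"
    using reg_ext_le reg_ext_ereal by (intro competitor_le psh_on_ereal[OF usc_reg reg_bound subavg_reg]) auto
  then show ?thesis using env_ext_le_reg_ext[OF z] env_ext_ereal[OF z] reg_ext_ereal[OF z] by auto
qed

lemma usc_env: "usc_on \<Omega> (\<lambda>z. ereal (env z))"
  using usc_on_cong[of \<Omega> "\<lambda>z. ereal (env z)" "\<lambda>z. ereal (reg z)"] reg_eq_env usc_reg by simp

lemma subavg_env: "subavg_lines \<Omega> env"
  unfolding subavg_lines_def
proof (intro allI impI, elim conjE)
  fix z b :: "complex ^ 'n" and r :: real
  assume r: "r > 0" and K: "\<forall>\<zeta>\<in>cball 0 r. z + \<zeta> *s b \<in> \<Omega>"
  have "z \<in> \<Omega>" using K[rule_format, of 0] r by simp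
  moreover have "env (z + (of_real r * exp (\<i> * of_real t)) *s b) = reg (z + (of_real r * exp (\<i> * of_real t)) *s b)" for t
    using K r by (intro reg_eq_env[symmetric]) (simp add: norm_mult)
  ultimately show "env z \<le> circle_avg (\<lambda>t. env (z + (of_real r * exp (\<i> * of_real t)) *s b))"
    using subavg_reg r K unfolding subavg_lines_def by (simp add: reg_eq_env[symmetric])
qed

section \<open>Rotated envelopes\<close>

definition rot :: "complex ^ 'n \<Rightarrow> complex ^ 'n \<Rightarrow> complex ^ 'n" where
  "rot l z = (\<chi> j. l $ j * z $ j)"

text \<open>Precomposition with the complex linear map \<open>rot l\<close> preserves the submean
  inequality on lines, so the rotated envelope lowered by \<open>e\<close> is a competitor; its
  value at \<open>z\<close> gives the bound.\<close>

lemma env_rot_le: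
  assumes l: "\<And>z. z \<in> \<Omega> \<Longrightarrow> rot l z \<in> \<Omega>" and e: "\<And>z. z \<in> \<Omega> \<Longrightarrow> \<phi> (rot l z) \<le> \<phi> z + e"
    and z: "z \<in> \<Omega>"
  shows "env (rot l z) \<le> env z + e"
proof -
  have lin: "rot l (w + \<zeta> *s b) = rot l w + \<zeta> *s rot l b" for w b \<zeta>
    by (simp add: rot_def vec_eq_iff algebra_simps)
  have "ereal (env (rot l z) - e) \<le> env_ext z"
  proof (rule competitor_le[OF psh_on_ereal])
    show "usc_on \<Omega> (\<lambda>z. ereal (env (rot l z) - e))"
    proof (rule usc_on_diff_continuous)
      show "usc_on \<Omega> (\<lambda>z. ereal (env (rot l z)))"
        by (rule usc_on_compose[OF usc_env]) (use l[unfolded rot_def] in \<open>auto simp: rot_def[abs_def] intro!: continuous_intros\<close>)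
    qed simp
    show "\<bar>env (rot l w) - e\<bar> \<le> M + \<bar>e\<bar>" if "w \<in> \<Omega>" for w using env_bound[OF l[OF that]] by simp
    show "ereal (env (rot l w) - e) \<le> ereal (\<phi> w)" if "w \<in> \<Omega>" for w
      using env_le[OF l[OF that]] e[OF that] by simp
    show "subavg_lines \<Omega> (\<lambda>w. env (rot l w) - e)"
      unfolding subavg_lines_def
    proof (intro allI impI, elim conjE)
      fix w b :: "complex ^ 'n" and r :: real
      assume r: "r > 0" and K: "\<forall>\<zeta>\<in>cball 0 r. w + \<zeta> *s b \<in> \<Omega>"
      have K': "rot l w + \<zeta> *s rot l b \<in> \<Omega>" if "\<zeta> \<in> cball 0 r" for \<zeta>
        using l K that by (metis lin)
      have "env (rot l w) \<le> circle_avg (\<lambda>t. env (rot l w + (of_real r * exp (\<i> * of_real t)) *s rot l b))"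
        using subavg_env r K' unfolding subavg_lines_def by blast
      moreover have "circle_integrable (\<lambda>t. env (rot l w + (of_real r * exp (\<i> * of_real t)) *s rot l b))"
        using r by (intro circle_integrable_line[OF usc_env env_bound] K') auto
      ultimately show "env (rot l w) - e \<le> circle_avg (\<lambda>t. env (rot l (w + (of_real r * exp (\<i> * of_real t)) *s b)) - e)"
        using circle_avg_add_const[of _ "- e"] by (simp add: lin)
    qed
  qed
  then show ?thesis using env_ext_ereal[OF z] by simp
qed

end

subsection \<open>Lower semicontinuity\<close>

text \<open>Common form of both cases: the excess \<open>e * k / (2 * pi)\<close> that the origin
  demands is at most \<open>e\<close>, so it also serves \<open>a \<noteq> 0\<close>.\<close>

lemma subavg_lower_bound:
  fixes a :: complex
  assumes t0: "t0 > 0" and k: "0 < k" "k \<le> 1"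
  shows "\<exists>s>0. \<forall>f b B e. e > 0 \<longrightarrow> usc_on (cball a t0) (\<lambda>z. ereal (f z)) \<longrightarrow> (\<forall>z\<in>cball a t0. \<bar>f z\<bar> \<le> B) \<longrightarrow>
    subavg_on (cball a t0) f \<longrightarrow> (\<forall>z\<in>cball a t0. f z \<le> f a + e * k / (2 * pi)) \<longrightarrow>
    (\<forall>z\<in>cball a t0. \<forall>z'\<in>cball a t0. norm z = norm z' \<longrightarrow> norm (z - z') \<le> k * norm z' \<longrightarrow> f z \<le> f z' + e) \<longrightarrow>
    dist b a < s \<longrightarrow> f b \<ge> f a - 3 * e"
proof (cases "a = 0")
  case True
  show ?thesis
    unfolding True
    by (intro exI[of _ t0] conjI allI impI t0) (rule subavg_lower_bound_zero[OF k _ t0], auto)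
next
  case False
  have "x * k / (2 * pi) \<le> x" if "x > 0" for x
  proof -
    have "x * k \<le> x * (2 * pi)" using k pi_ge_two that by (intro mult_left_mono) auto
    then show ?thesis by (simp add: divide_le_eq)
  qed
  then have le: "f z \<le> f a + e" if "e > 0" "f z \<le> f a + e * k / (2 * pi)" for f :: "complex \<Rightarrow> real" and z e
    using that by (meson add_left_mono order_trans)
  obtain s where s: "s > 0" and lower: "\<forall>f b B e. e > 0 \<longrightarrow> usc_on (cball a t0) (\<lambda>z. ereal (f z)) \<longrightarrow>
    (\<forall>z\<in>cball a t0. \<bar>f z\<bar> \<le> B) \<longrightarrow> subavg_on (cball a t0) f \<longrightarrow> (\<forall>z\<in>cball a t0. f z \<le> f a + e) \<longrightarrow>
    (\<forall>z\<in>cball a t0. \<forall>z'\<in>cball a t0. norm z = norm z' \<longrightarrow> norm (z - z') \<le> k * norm z' \<longrightarrow> f z \<le> f z' + e) \<longrightarrow>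
    dist b a < s \<longrightarrow> f b \<ge> f a - 3 * e"
    using subavg_lower_bound_nonzero[OF False t0 k(1)] by (elim exE conjE)
  show ?thesis
  proof (intro exI[of _ s] conjI allI impI s)
    fix f b B and e :: real
    assume e: "e > 0" and "\<forall>z\<in>cball a t0. f z \<le> f a + e * k / (2 * pi)"
    then have "\<forall>z\<in>cball a t0. f z \<le> f a + e" using le by blast
    moreover assume "usc_on (cball a t0) (\<lambda>z. ereal (f z))" "\<forall>z\<in>cball a t0. \<bar>f z\<bar> \<le> B" "subavg_on (cball a t0) f"
      "\<forall>z\<in>cball a t0. \<forall>z'\<in>cball a t0. norm z = norm z' \<longrightarrow> norm (z - z') \<le> k * norm z' \<longrightarrow> f z \<le> f z' + e"
      "dist b a < s"
    ultimately show "f a - 3 * e \<le> f b" using lower[THEN spec, THEN spec, THEN spec, THEN spec, of e f B b] e by simp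
  qed
qed

section \<open>Changing one coordinate of a vector\<close>

definition upd :: "'a ^ 'n \<Rightarrow> 'n \<Rightarrow> 'a \<Rightarrow> 'a ^ 'n" where
  "upd z j x = (\<chi> i. if i = j then x else z $ i)"

lemma upd_line: "upd z j x = upd z j 0 + x *s axis j 1" for x :: complex
  by (simp add: upd_def vec_eq_iff axis_def)

lemma upd_self [simp]: "upd z j (z $ j) = z"
  by (simp add: upd_def vec_eq_iff)

lemma dist_upd: "dist (upd z j x) (upd z j y) = dist x y" for x :: complex
proof -
  have "dist (upd z j x) (upd z j y) = L2_set (\<lambda>i. if i = j then dist x y else 0) UNIV"
    unfolding dist_vec_def by (intro arg_cong2[where f = L2_set] ext) (auto simp: upd_def)
  also have "\<dots> = dist x y"
    by (simp add: L2_set_def if_distrib[of "\<lambda>x. x ^ 2"] cong: if_cong)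
  finally show ?thesis .
qed

lemma dist_vec_le_card:
  fixes x y :: "complex ^ 'n"
  assumes "\<And>i. dist (x $ i) (y $ i) \<le> s"
  shows "dist x y \<le> real CARD('n) * s"
proof -
  have "dist x y \<le> (\<Sum>i\<in>UNIV. dist (x $ i) (y $ i))"
    unfolding dist_vec_def by (rule L2_set_le_sum) auto
  also have "\<dots> \<le> real CARD('n) * s" using assms by (intro sum_bounded_above) auto
  finally show ?thesis .
qed

context perron_obstacle
begin

text \<open>Induction over the coordinates allowed to differ. Resetting coordinate \<open>j\<close>
  to its value in \<open>z0\<close> gives a point covered by the induction hypothesis, and
  \<open>subavg_lower_bound\<close> on the slice through it compares the two values of coordinate
  \<open>j\<close>.\<close>

lemma env_lower_coordinates:
  assumes rotate: "\<And>e. e > 0 \<Longrightarrow> \<exists>k>0. k \<le> 1 \<and> (\<forall>j l z. norm l = 1 \<longrightarrow> norm (l - 1) \<le> k \<longrightarrow> z \<in> \<Omega> \<longrightarrow>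
      env (upd z j (l * z $ j)) \<le> env z + e)"
    and z0: "z0 \<in> \<Omega>" and S: "finite S"
  shows "e > 0 \<Longrightarrow> \<exists>s>0. \<forall>z. (\<forall>j\<in>S. dist (z $ j) (z0 $ j) < s) \<longrightarrow> (\<forall>j. j \<notin> S \<longrightarrow> z $ j = z0 $ j) \<longrightarrow> env z \<ge> env z0 - e"
  using S
proof (induction S arbitrary: e rule: finite_induct)
  case empty
  have "env z \<ge> env z0 - e" if "\<forall>j. z $ j = z0 $ j" for z
  proof -
    have "z = z0" using that by (simp add: vec_eq_iff)
    then show ?thesis using empty by simp
  qed
  then show ?case by (intro exI[of _ 1]) simp
next
  case (insert j S)
  \<comment> \<open>The slice costs \<open>3 * e1\<close>, the induction hypothesis at most one more
    \<open>e1\<close>.\<close>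
  define e1 where "e1 = e / 4"
  have e1: "e1 > 0" using insert.prems by (simp add: e1_def)
  obtain k where k: "0 < k" "k \<le> 1"
    and r: "\<forall>j l z. norm l = 1 \<longrightarrow> norm (l - 1) \<le> k \<longrightarrow> z \<in> \<Omega> \<longrightarrow> env (upd z j (l * z $ j)) \<le> env z + e1"
    using rotate[OF e1] by blast
  note rot = r[rule_format]
  \<comment> \<open>The excess that \<open>subavg_lower_bound\<close> allows: one half is spent on
    upper semicontinuity at \<open>z0\<close>, the other on the induction hypothesis.\<close>
  define d where "d = e1 * k / (2 * pi)"
  have "e1 * k \<le> e1 * (2 * pi)" using k pi_ge_two e1 by (intro mult_left_mono) auto
  then have d: "d > 0" "d \<le> e1" using e1 k by (simp_all add: d_def divide_le_eq)
  have "open {y \<in> \<Omega>. ereal (env y) < ereal (env z0 + d / 2)}"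
    using usc_env unfolding usc_on_def openin_open_eq[OF open_domain] by blast
  moreover have "z0 \<in> {y \<in> \<Omega>. ereal (env y) < ereal (env z0 + d / 2)}" using z0 d by simp
  ultimately obtain T where T: "T > 0" "cball z0 T \<subseteq> {y \<in> \<Omega>. ereal (env y) < ereal (env z0 + d / 2)}"
    unfolding open_contains_cball by blast
  then have T': "y \<in> \<Omega>" "env y \<le> env z0 + d / 2" if "dist y z0 \<le> T" for y
    using that by (auto simp: dist_commute subset_iff less_imp_le)
  obtain s1 where s1: "s1 > 0"
    "\<And>z. \<lbrakk>\<And>i. i \<in> S \<Longrightarrow> dist (z $ i) (z0 $ i) < s1; \<And>i. i \<notin> S \<Longrightarrow> z $ i = z0 $ i\<rbrakk> \<Longrightarrow> env z \<ge> env z0 - d / 2"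
    using insert.IH[of "d / 2"] d by auto
  define a where "a = z0 $ j"
  obtain s2 where s2: "s2 > 0" "\<And>f b B e. \<lbrakk>e > 0; usc_on (cball a (T / 2)) (\<lambda>z. ereal (f z));
     \<forall>z\<in>cball a (T / 2). \<bar>f z\<bar> \<le> B;
    subavg_on (cball a (T / 2)) f; \<forall>z\<in>cball a (T / 2). f z \<le> f a + e * k / (2 * pi);
    \<forall>z\<in>cball a (T / 2). \<forall>z'\<in>cball a (T / 2). norm z = norm z' \<longrightarrow> norm (z - z') \<le> k * norm z' \<longrightarrow> f z \<le> f z' + e;
    dist b a < s2\<rbrakk> \<Longrightarrow> f b \<ge> f a - 3 * e"
  proof -
    have "T / 2 > 0" using T(1) by simp
    from subavg_lower_bound[OF this k, of a] show ?thesis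
      using that by (elim exE conjE) (rule that, assumption, blast)
  qed
  \<comment> \<open>The last bound puts the centre of the slice within \<open>T / 2\<close> of
    \<open>z0\<close>, so that a disc of radius \<open>T / 2\<close> in the slice stays within
    \<open>T\<close> of \<open>z0\<close>.\<close>
  define s where "s = min (min s1 s2) (T / (2 * real CARD('n)))"
  show ?case
  proof (intro exI[of _ s] conjI allI impI)
    show "s > 0" using s1(1) s2(1) T(1) by (simp add: s_def)
    fix z assume near: "\<forall>i\<in>insert j S. dist (z $ i) (z0 $ i) < s" and same: "\<forall>i. i \<notin> insert j S \<longrightarrow> z $ i = z0 $ i"
    define f where "f x = env (upd z j x)" for x
    have "dist (upd z j a $ i) (z0 $ i) \<le> T / (2 * real CARD('n))" for i
      using near same T(1) by (cases "i \<in> S"; cases "i = j") (auto simp: upd_def a_def s_def intro: less_imp_le)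
    from dist_vec_le_card[OF this] have w: "dist (upd z j a) z0 \<le> T / 2" by simp
    have f_dist: "dist (upd z j x) z0 \<le> T" if "x \<in> cball a (T / 2)" for x
      using dist_triangle[of "upd z j x" z0 "upd z j a"] w that by (simp add: dist_upd dist_commute)
    have fa: "f a \<ge> env z0 - d / 2"
      unfolding f_def
    proof (rule s1(2))
      show "dist (upd z j a $ i) (z0 $ i) < s1" if "i \<in> S" for i
        using near that insert.hyps by (auto simp: upd_def s_def)
      show "upd z j a $ i = z0 $ i" if "i \<notin> S" for i
        using same that by (auto simp: upd_def a_def)
    qed
    have "f (z $ j) \<ge> f a - 3 * e1"
    proof (rule s2(2)[OF e1])
      have line: "f = (\<lambda>x. env (upd z j 0 + x *s axis j 1))"
        unfolding f_def by (subst upd_line) (rule refl)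
      have in_line: "upd z j 0 + x *s axis j 1 \<in> \<Omega>" if "x \<in> cball a (T / 2)" for x
        using T'(1)[OF f_dist[OF that]] upd_line[of z j x] by simp
      show "usc_on (cball a (T / 2)) (\<lambda>x. ereal (f x))"
        unfolding line using in_line
        by (intro usc_on_compose[OF usc_env] continuous_on_complex_line continuous_intros) auto
      show "\<forall>x\<in>cball a (T / 2). \<bar>f x\<bar> \<le> M"
        unfolding f_def using env_bound T'(1) f_dist by blast
      show "subavg_on (cball a (T / 2)) f"
        unfolding line by (rule subavg_lines_line[OF subavg_env in_line])
      show "\<forall>x\<in>cball a (T / 2). f x \<le> f a + e1 * k / (2 * pi)"
      proof
        fix x assume "x \<in> cball a (T / 2)"
        then have "f x \<le> env z0 + d / 2" unfolding f_def by (intro T'(2) f_dist)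
        then show "f x \<le> f a + e1 * k / (2 * pi)" unfolding d_def[symmetric] using fa d(1) by linarith
      qed
      show "\<forall>x\<in>cball a (T / 2). \<forall>y\<in>cball a (T / 2). norm x = norm y \<longrightarrow> norm (x - y) \<le> k * norm y \<longrightarrow> f x \<le> f y + e1"
      proof (intro ballI impI)
        fix x y assume x: "x \<in> cball a (T / 2)" and y: "y \<in> cball a (T / 2)"
          and xy: "norm x = norm y" "norm (x - y) \<le> k * norm y"
        show "f x \<le> f y + e1"
        \<comment> \<open>For \<open>y = 0\<close> equal norms force \<open>x = y\<close>; otherwise
          \<open>x / y\<close> is the unimodular factor that rotates \<open>y\<close> to
          \<open>x\<close>.\<close>
        proof (cases "y = 0")
          case True
          then show ?thesis using xy e1 by simp
        next
          case False
          have "x / y - 1 = (x - y) / y" using False by (simp add: diff_divide_distrib)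
          then have "norm (x / y - 1) = norm (x - y) / norm y" by (simp only: norm_divide)
          then have 1: "norm (x / y - 1) \<le> k" using xy False by (simp add: divide_le_eq)
          have 2: "norm (x / y) = 1" using xy False by (simp add: norm_divide)
          have "upd (upd z j y) j (x / y * upd z j y $ j) = upd z j x"
            using False by (simp add: upd_def vec_eq_iff)
          then show ?thesis using rot[OF 2 1 T'(1)[OF f_dist[OF y]], of j] by (simp add: f_def)
        qed
      qed
      show "dist (z $ j) a < s2" using near by (simp add: a_def s_def)
    qed
    then show "env z \<ge> env z0 - e" using fa d by (simp add: f_def e1_def)
  qed
qed

text \<open>The upper half is \<open>usc_env\<close>; the lower half is
  \<open>env_lower_coordinates\<close> with all coordinates free.\<close>

lemma env_continuous:
  assumes rotate: "\<And>e. e > 0 \<Longrightarrow> \<exists>k>0. k \<le> 1 \<and> (\<forall>j l z. norm l = 1 \<longrightarrow> norm (l - 1) \<le> k \<longrightarrow> z \<in> \<Omega> \<longrightarrow>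
      env (upd z j (l * z $ j)) \<le> env z + e)"
  shows "continuous_on \<Omega> env"
  unfolding continuous_on_def
proof
  fix z0 assume z0: "z0 \<in> \<Omega>"
  show "(env \<longlongrightarrow> env z0) (at z0 within \<Omega>)"
  proof (rule order_tendstoI)
    fix c assume c: "c < env z0"
    then have "(env z0 - c) / 2 > 0" by simp
    from env_lower_coordinates[OF rotate z0 finite this]
    obtain s where s: "s > 0" "\<forall>z. (\<forall>j\<in>UNIV. dist (z $ j) (z0 $ j) < s) \<longrightarrow>
      (\<forall>j. j \<notin> UNIV \<longrightarrow> z $ j = z0 $ j) \<longrightarrow> env z \<ge> env z0 - (env z0 - c) / 2"
      by blast
    have "c < env z" if "dist z z0 < s" for z
    proof -
      have "env z \<ge> env z0 - (env z0 - c) / 2"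
        using that dist_vec_nth_le[of z _ z0] by (intro s(2)[rule_format]) (auto intro: order_le_less_trans)
      moreover have "env z0 - (env z0 - c) / 2 > c" using c by (simp add: field_simps)
      ultimately show ?thesis by linarith
    qed
    then show "\<forall>\<^sub>F z in at z0 within \<Omega>. c < env z" unfolding eventually_at using s(1) by blast
  next
    fix c assume "env z0 < c"
    then have "ereal (env z0) < ereal c" by simp
    with usc_env z0 have "\<forall>\<^sub>F z in at z0 within \<Omega>. ereal (env z) < ereal c"
      unfolding usc_on_eventually by blast
    then show "\<forall>\<^sub>F z in at z0 within \<Omega>. env z < c" by simp
  qed
qed

end

text \<open>The arguments of the unimodular entries serve as the angles in
  \<open>Reinhardt\<close>.\<close>

lemma Reinhardt_rotate:
  assumes "Reinhardt S" "z \<in> S" "\<And>j. norm (l $ j) = 1"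
  shows "(\<chi> j. l $ j * z $ j) \<in> S"
proof -
  have "exp (\<i> * of_real (Arg (l $ j))) = l $ j" for j
    using Arg_eq[of "l $ j"] assms(3)[of j] by force
  then have "(\<chi> j. exp (\<i> * of_real ((\<chi> j. Arg (l $ j)) $ j)) * z $ j) = (\<chi> j. l $ j * z $ j)"
    by simp
  then show ?thesis using assms(1,2) unfolding Reinhardt_def by metis
qed

text \<open>Finiteness stands beside continuity because \<open>real_of_ereal\<close> would turn an
  infinite value into 0. Boundedness of the domain makes \<open>\<phi>\<close> bounded and turns a
  small rotation into a uniformly small displacement, to which uniform continuity applies.\<close>

theorem corollary3p3:
  fixes \<Omega> :: "(complex ^ 'n) set" and \<phi> :: "complex ^ 'n \<Rightarrow> real"
  assumes "domain_in \<Omega>" and "bounded \<Omega>" and "Reinhardt \<Omega>"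
    and "uniformly_continuous_on \<Omega> \<phi>"
  shows "(\<forall>z\<in>\<Omega>. \<bar>Perron_Bremermann \<Omega> \<phi> z\<bar> \<noteq> \<infinity>) \<and>
         continuous_on \<Omega> (\<lambda>z. real_of_ereal (Perron_Bremermann \<Omega> \<phi> z))"
proof -
  have "bounded (\<phi> ` \<Omega>)" using assms by (intro bounded_uniformly_continuous_image)
  then obtain M where M: "\<And>z. z \<in> \<Omega> \<Longrightarrow> \<bar>\<phi> z\<bar> \<le> M" unfolding bounded_iff by auto
  obtain R where R: "R > 0" "\<And>z. z \<in> \<Omega> \<Longrightarrow> norm z \<le> R" using \<open>bounded \<Omega>\<close> bounded_pos by blast
  interpret perron_obstacle \<Omega> \<phi> M
    using assms M by unfold_locales (auto simp: domain_in_def uniformly_continuous_imp_continuous)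
  have "continuous_on \<Omega> env"
  proof (rule env_continuous)
    fix e :: real assume e: "e > 0"
    then obtain \<delta> where \<delta>: "\<delta> > 0" "\<And>x y. x \<in> \<Omega> \<Longrightarrow> y \<in> \<Omega> \<Longrightarrow> dist y x < \<delta> \<Longrightarrow> dist (\<phi> y) (\<phi> x) < e"
      using assms(4) unfolding uniformly_continuous_on_def by metis
    show "\<exists>k>0. k \<le> 1 \<and> (\<forall>j l z. norm l = 1 \<longrightarrow> norm (l - 1) \<le> k \<longrightarrow> z \<in> \<Omega> \<longrightarrow>
      env (upd z j (l * z $ j)) \<le> env z + e)"
    \<comment> \<open>A factor \<open>l\<close> displaces a point by at most
      \<open>norm (l - 1) * R\<close>, hence by at most \<open>\<delta> / 2\<close>, strictly below
      \<open>\<delta>\<close>.\<close>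
    proof (intro exI[of _ "min 1 (\<delta> / (2 * R))"] conjI allI impI)
      show "min 1 (\<delta> / (2 * R)) > 0" using \<delta>(1) R(1) by simp
      fix j :: 'n and l :: complex and z
      assume l: "norm l = 1" "norm (l - 1) \<le> min 1 (\<delta> / (2 * R))" and z: "z \<in> \<Omega>"
      define v :: "complex ^ 'n" where "v = (\<chi> i. if i = j then l else 1)"
      have v: "rot v w = upd w j (l * w $ j)" for w
        by (auto simp: rot_def v_def upd_def vec_eq_iff)
      have v_in: "rot v w \<in> \<Omega>" if "w \<in> \<Omega>" for w
        unfolding rot_def by (rule Reinhardt_rotate[OF assms(3) that]) (simp add: v_def l)
      have "env (rot v z) \<le> env z + e"
      proof (rule env_rot_le[OF v_in _ z])
        fix w assume w: "w \<in> \<Omega>"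
        have "dist (rot v w) w = dist (l * w $ j) (w $ j)"
          unfolding v using dist_upd[of w j "l * w $ j" "w $ j"] by simp
        also have "\<dots> = norm (l - 1) * norm (w $ j)"
          by (simp add: dist_norm norm_mult[symmetric] left_diff_distrib)
        also have "\<dots> \<le> \<delta> / (2 * R) * R"
        proof (rule mult_mono)
          show "norm (w $ j) \<le> R" using Finite_Cartesian_Product.norm_nth_le[of w j] R(2)[OF w] by linarith
        qed (use l(2) R(1) \<delta>(1) in auto)
        also have "\<dots> < \<delta>" using R(1) \<delta>(1) by simp
        finally show "\<phi> (rot v w) \<le> \<phi> w + e" using \<delta>(2)[OF w v_in[OF w]] by (simp add: dist_real_def)
      qed
      then show "env (upd z j (l * z $ j)) \<le> env z + e" by (simp add: v)
    qed simp
  qed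
  moreover have "\<bar>Perron_Bremermann \<Omega> \<phi> z\<bar> \<noteq> \<infinity>" if "z \<in> \<Omega>" for z
    using env_ext_ereal[OF that] by (simp add: env_ext_def)
  ultimately show ?thesis by (simp add: env_def[abs_def] env_ext_def)
qed

end
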